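(* For every integer $n\geq 1$, every $n$-vertex outerpath $G$, and every integer $k\geq 3$, there exists a set $\mathcal I\subseteq V(G)$ such that $G[\mathcal I]$ has maximum degree at most $k$ and $|\mathcal I|\geq \frac{k-1}{k}n$.
   Context: Graphs are finite and simple. For $\mathcal I\subseteq V(G)$, $G[\mathcal I]$ is the subgraph induced by $\mathcal I$; the degree of a graph is its maximum vertex degree. An outerplanar graph is a graph admitting a planar drawing with all vertices on the outer face; it is maximal outerplanar if no edge can be added keeping it simple and outerplanar. A maximal outerplanar graph has an essentially unique outerplanar embedding whose internal faces are triangles; its weak dual is the graph with one vertex per internal face, two being adjacent when the faces share an edge. A maximal outerpath is a maximal outerplanar graph whose weak dual is a path, and an outerpath is a subgraph of a maximal outerpath. *)

theory Defs
  imports "HOL-Analysis.Analysis"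
begin

text \<open>Graphs are pairs of a vertex set and a set of two-element edges.\<close>

type_synonym 'a ugraph = "'a set \<times> 'a set set"

abbreviation verts :: "'a ugraph \<Rightarrow> 'a set" where "verts \<equiv> fst"
abbreviation edges :: "'a ugraph \<Rightarrow> 'a set set" where "edges \<equiv> snd"

definition simple_graph :: "'a ugraph \<Rightarrow> bool" where
  "simple_graph G \<longleftrightarrow> finite (verts G) \<and> (\<forall>e\<in>edges G. e \<subseteq> verts G \<and> card e = 2)"

definition induced_subgraph :: "'a ugraph \<Rightarrow> 'a set \<Rightarrow> 'a ugraph" where
  "induced_subgraph G I = (verts G \<inter> I, {e \<in> edges G. e \<subseteq> I})"

definition degree :: "'a ugraph \<Rightarrow> 'a \<Rightarrow> nat" where
  "degree G v = card {e \<in> edges G. v \<in> e}"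

text \<open>The maximum degree is only meaningful for graphs with at least one vertex.\<close>

definition max_degree :: "'a ugraph \<Rightarrow> nat" where
  "max_degree G = Max (degree G ` verts G)"

definition path_graph :: "'a ugraph \<Rightarrow> bool" where
  "path_graph G \<longleftrightarrow> (\<exists>xs. xs \<noteq> [] \<and> distinct xs \<and> verts G = set xs \<and>
     edges G = {{xs ! i, xs ! Suc i} | i. Suc i < length xs})"

text \<open>A drawing consists of a point for every vertex and a Jordan arc in the plane for
  every edge.\<close>

definition planar_drawing ::
    "'a ugraph \<Rightarrow> ('a \<Rightarrow> complex) \<Rightarrow> ('a set \<Rightarrow> real \<Rightarrow> complex) \<Rightarrow> bool" where
  "planar_drawing G p \<gamma> \<longleftrightarrow>
     inj_on p (verts G) \<and>
     (\<forall>e\<in>edges G. arc (\<gamma> e) \<and> {pathstart (\<gamma> e), pathfinish (\<gamma> e)} = p ` e) \<and>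
     (\<forall>e\<in>edges G. \<forall>v\<in>verts G. p v \<in> path_image (\<gamma> e) \<longrightarrow> v \<in> e) \<and>
     (\<forall>e\<in>edges G. \<forall>f\<in>edges G. e \<noteq> f \<longrightarrow>
        path_image (\<gamma> e) \<inter> path_image (\<gamma> f) \<subseteq> p ` (e \<inter> f))"

definition drawn_points ::
    "'a ugraph \<Rightarrow> ('a \<Rightarrow> complex) \<Rightarrow> ('a set \<Rightarrow> real \<Rightarrow> complex) \<Rightarrow> complex set" where
  "drawn_points G p \<gamma> = p ` verts G \<union> (\<Union>e\<in>edges G. path_image (\<gamma> e))"

text \<open>The set of drawn points is compact, so its \<^const>\<open>outside\<close> is the unique unbounded
  face; a vertex is on the outer face if it lies on the boundary of that face.\<close>

definition outerplanar_drawing ::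
    "'a ugraph \<Rightarrow> ('a \<Rightarrow> complex) \<Rightarrow> ('a set \<Rightarrow> real \<Rightarrow> complex) \<Rightarrow> bool" where
  "outerplanar_drawing G p \<gamma> \<longleftrightarrow>
     planar_drawing G p \<gamma> \<and> p ` verts G \<subseteq> frontier (outside (drawn_points G p \<gamma>))"

definition outerplanar :: "'a ugraph \<Rightarrow> bool" where
  "outerplanar G \<longleftrightarrow> simple_graph G \<and> (\<exists>p \<gamma>. outerplanar_drawing G p \<gamma>)"

definition maximal_outerplanar :: "'a ugraph \<Rightarrow> bool" where
  "maximal_outerplanar G \<longleftrightarrow> outerplanar G \<and>
     (\<forall>u\<in>verts G. \<forall>v\<in>verts G. u \<noteq> v \<longrightarrow> {u, v} \<notin> edges G \<longrightarrow>
        \<not> outerplanar (verts G, insert {u, v} (edges G)))"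

definition internal_faces ::
    "'a ugraph \<Rightarrow> ('a \<Rightarrow> complex) \<Rightarrow> ('a set \<Rightarrow> real \<Rightarrow> complex) \<Rightarrow> complex set set" where
  "internal_faces G p \<gamma> = {F \<in> components (- drawn_points G p \<gamma>). bounded F}"

definition weak_dual ::
    "'a ugraph \<Rightarrow> ('a \<Rightarrow> complex) \<Rightarrow> ('a set \<Rightarrow> real \<Rightarrow> complex) \<Rightarrow> complex set ugraph" where
  "weak_dual G p \<gamma> =
     (internal_faces G p \<gamma>,
      {{F, F'} | F F'. F \<in> internal_faces G p \<gamma> \<and> F' \<in> internal_faces G p \<gamma> \<and> F \<noteq> F' \<and>
         (\<exists>e\<in>edges G. path_image (\<gamma> e) \<subseteq> frontier F \<inter> frontier F')})"

text \<open>The outerplanar embedding of a maximal outerplanar graph is essentially unique, so it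
  does not matter which outerplanar drawing is used to form the weak dual.\<close>

definition maximal_outerpath :: "'a ugraph \<Rightarrow> bool" where
  "maximal_outerpath G \<longleftrightarrow> maximal_outerplanar G \<and>
     (\<exists>p \<gamma>. outerplanar_drawing G p \<gamma> \<and> path_graph (weak_dual G p \<gamma>))"

text \<open>The maximal outerpath may have more vertices than \<open>G\<close>, and possibly more than the
  type \<^typ>\<open>'a\<close> has elements. It is therefore taken over \<^typ>\<open>nat\<close>, where every finite graph
  has an isomorphic copy, and \<open>G\<close> is embedded into it. A path has at least one vertex, so
  graphs without internal faces are not maximal outerpaths themselves, but those with at most
  two vertices are outerpaths as subgraphs of a triangle.\<close>

definition outerpath :: "'a ugraph \<Rightarrow> bool" where
  "outerpath G \<longleftrightarrow> simple_graph G \<and>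
     (\<exists>(H :: nat ugraph) \<phi>. maximal_outerpath H \<and> inj_on \<phi> (verts G) \<and>
        \<phi> ` verts G \<subseteq> verts H \<and> (\<forall>e\<in>edges G. \<phi> ` e \<in> edges H))"

end

theory Submission
  imports Defs
begin

text \<open>
  A maximal outerpath is a strip of triangles. Listing its vertices in the order in which the strip
  is built gives a linear order in which two long edges with distinct left ends overlap in at most
  one step (\<open>strip_order\<close>). This property is hereditary, so it suffices to delete vertices from
  an arbitrary graph with such an order: at the first vertex \<open>h\<close> of degree greater than \<open>k\<close>, with
  last neighbour \<open>r\<close>, the vertices up to \<open>r\<close> are nearly cut off from the rest, and one deletion
  (of \<open>h\<close>, or of the predecessor of \<open>r\<close>) settles at least \<open>k\<close> of them.

  To find the order, a topological drawing is first turned into a linear order in which no two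
  edges cross. In a theta curve one of the three arcs lies inside the cycle formed by the other two
  (by Janiszewski's theorem), so an outerplanar drawing contains no theta graph with three
  subdivided arcs and no cycle with crossing chords. Hence in the absence of cut vertices a longest
  cycle is Hamiltonian and its order is noncrossing. Conversely, a noncrossing order gives a
  straight-line drawing on a parabola, so maximality says that every non-edge is crossed by an
  edge, which makes the graph a triangulated polygon. The interior of every triangle is an internal
  face of the given drawing; therefore, as the weak dual is a path, no triangle shares all three of
  its sides with other triangles, and the triangulation can be peeled off vertex by vertex.
\<close>

section \<open>Deleting vertices along a strip\<close>

definition nbrs :: "'a set set \<Rightarrow> 'a set \<Rightarrow> 'a \<Rightarrow> 'a set" where
  "nbrs E S v = {u \<in> S. {u, v} \<in> E}"

text \<open>Apart from edges between consecutive vertices, the intervals spanned by two edges with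
  distinct left ends \<open>a\<close> and \<open>c\<close> share at most one step.\<close>

definition strip_order :: "('a \<Rightarrow> nat) \<Rightarrow> 'a set \<Rightarrow> 'a set set \<Rightarrow> bool" where
  "strip_order q S E \<longleftrightarrow> inj_on q S \<and>
     (\<forall>a\<in>S. \<forall>b\<in>S. \<forall>c\<in>S. \<forall>d\<in>S. \<forall>x\<in>S. \<forall>y\<in>S. {a, b} \<in> E \<longrightarrow> {c, d} \<in> E \<longrightarrow>
        q a < q c \<longrightarrow> q c < q x \<longrightarrow> q x < q b \<longrightarrow> q c < q y \<longrightarrow> q y < q d \<longrightarrow> False)"

lemma strip_orderD:
  assumes "strip_order q S E" "{a, b, c, d, x, y} \<subseteq> S" "{a, b} \<in> E" "{c, d} \<in> E"
    and "q a < q c" "q c < q x" "q x < q b" "q c < q y" "q y < q d"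
  shows False
  using assms unfolding strip_order_def by blast

lemma strip_order_subset: "strip_order q S E \<Longrightarrow> T \<subseteq> S \<Longrightarrow> strip_order q T E"
  unfolding strip_order_def by (meson inj_on_subset subsetD)

lemma card_le_twoI:
  fixes q :: "'a \<Rightarrow> nat"
  assumes "finite A" "inj_on q A"
    and "\<And>a b c. a \<in> A \<Longrightarrow> b \<in> A \<Longrightarrow> c \<in> A \<Longrightarrow> q a < q b \<Longrightarrow> q b < q c \<Longrightarrow> False"
  shows "card A \<le> 2"
proof (rule ccontr)
  assume "\<not> card A \<le> 2"
  then obtain T where "T \<subseteq> A" "card T = 3" using obtain_subset_with_card_n[of 3 A] by auto
  then obtain a b c where "a \<in> A" "b \<in> A" "c \<in> A" "a \<noteq> b" "b \<noteq> c" "a \<noteq> c"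
    by (auto simp: card_3_iff)
  moreover from this have "q a \<noteq> q b" "q b \<noteq> q c" "q a \<noteq> q c" using assms(2) by (auto simp: inj_on_def)
  ultimately show False using assms(3) by (metis linorder_neqE_nat)
qed

lemma finite_has_greatest:
  fixes q :: "'a \<Rightarrow> nat"
  assumes "finite A" "A \<noteq> {}"
  obtains m where "m \<in> A" "\<And>u. u \<in> A \<Longrightarrow> q u \<le> q m"
proof -
  have "Max (q ` A) \<in> q ` A" using assms by (intro Max_in) auto
  then obtain m where "m \<in> A" "q m = Max (q ` A)" by auto
  then show ?thesis using that[of m] Max_ge[of "q ` A"] assms(1) by auto
qed

text \<open>Of three earlier neighbours of \<open>v\<close>, the two leftmost would start edges to
  \<open>v\<close> that both jump over the third.\<close>

lemma strip_back_nbrs: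
  assumes "strip_order q S E" "finite S" "v \<in> S"
  shows "card {u \<in> nbrs E S v. q u < q v} \<le> 2"
proof (rule card_le_twoI[where q = q])
  show "inj_on q {u \<in> nbrs E S v. q u < q v}"
    using assms(1) by (auto simp: strip_order_def nbrs_def intro: inj_on_subset)
  fix a b c assume "a \<in> {u \<in> nbrs E S v. q u < q v}" "b \<in> {u \<in> nbrs E S v. q u < q v}"
    "c \<in> {u \<in> nbrs E S v. q u < q v}" "q a < q b" "q b < q c"
  then show False using strip_orderD[OF assms(1), of a v b v c c] assms(3) by (auto simp: nbrs_def)
qed (use assms in \<open>auto simp: nbrs_def\<close>)

text \<open>Induction on the number of vertices. A deleted vertex is paid for by a set
  \<open>?B\<close> of at least \<open>k\<close> vertices that contains it and is left out of the
  recursion. Each surviving vertex either has at most \<open>k\<close> surviving neighbours in all,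
  or has none in \<open>?B\<close>, so that the recursive bound applies to it.\<close>

lemma strip_deletion:
  fixes q :: "'a \<Rightarrow> nat"
  assumes "finite S" "strip_order q S E" "k \<ge> 3" "\<forall>v\<in>S. {v} \<notin> E"
  shows "\<exists>D\<subseteq>S. k * card D \<le> card S \<and> (\<forall>v\<in>S - D. card (nbrs E (S - D) v) \<le> k)"
  using assms(1,2,4)
proof (induction "card S" arbitrary: S rule: less_induct)
  case less
  note fin = less.prems(1) and strip = less.prems(2) and loopless = less.prems(3)
  have inj: "inj_on q S" using strip by (simp add: strip_order_def)
  have q_neq: "q u \<noteq> q v" if "u \<in> S" "v \<in> S" "u \<noteq> v" for u v
    using inj that by (auto simp: inj_on_def)
  have fin_nbrs: "finite (nbrs E T v)" if "T \<subseteq> S" for T v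
    using fin that by (auto simp: nbrs_def intro: finite_subset)
  have nbrs_mono: "card (nbrs E T v) \<le> card (nbrs E T' v)" if "T \<subseteq> T'" "T' \<subseteq> S" for T T' v
    using that fin_nbrs by (intro card_mono) (auto simp: nbrs_def)
  show ?case
  proof (cases "\<forall>v\<in>S. card (nbrs E S v) \<le> k")
    case True
    then show ?thesis by (intro exI[of _ "{}"]) auto
  next
    case False
    define bad where "bad = {v \<in> S. \<not> card (nbrs E S v) \<le> k}"
    obtain h where h: "h \<in> bad" "\<forall>v\<in>bad. q h \<le> q v"
      using False ex_has_least_nat[of "\<lambda>v. v \<in> bad" _ q] by (auto simp: bad_def)
    have hS: "h \<in> S" and h_deg: "k < card (nbrs E S h)" using h by (auto simp: bad_def)
    have before_h: "card (nbrs E S v) \<le> k" if "v \<in> S" "q v < q h" for v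
      using h that by (force simp: bad_def)
    define fwd where "fwd = {u \<in> nbrs E S h. q h < q u}"
    have "nbrs E S h = {u \<in> nbrs E S h. q u < q h} \<union> fwd"
      using q_neq hS loopless by (force simp: nbrs_def fwd_def)
    then have "card (nbrs E S h) \<le> card {u \<in> nbrs E S h. q u < q h} + card fwd"
      by (metis card_Un_le)
    \<comment> \<open>Here \<open>k \<ge> 3\<close> enters: \<open>h\<close> has at least four
      neighbours, of which at most two come earlier.\<close>
    then have fwd2: "2 \<le> card fwd"
      using strip_back_nbrs[OF strip fin hS] h_deg assms(3) by simp
    have fin_fwd: "finite fwd" using fin_nbrs[of S h] by (simp add: fwd_def)
    have "fwd \<noteq> {}" using fwd2 by auto
    then obtain r where r: "r \<in> fwd" "\<And>u. u \<in> fwd \<Longrightarrow> q u \<le> q r"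
      using finite_has_greatest[OF fin_fwd] by metis
    have rS: "r \<in> S" and hr: "{h, r} \<in> E" "q h < q r"
      using r by (auto simp: nbrs_def insert_commute fwd_def)
    have "card (fwd - {r}) \<noteq> 0" using fwd2 r(1) fin_fwd by simp
    then obtain w where w: "w \<in> fwd" "w \<noteq> r" by (metis DiffD1 DiffD2 card.empty ex_in_conv singletonI)
    have wr: "w \<in> S" "q h < q w" "q w < q r" using w r(2)[of w] q_neq[of w r] rS by (auto simp: nbrs_def fwd_def)
    \<comment> \<open>The immediate predecessor of \<open>r\<close>. The vertex \<open>w\<close>
      between \<open>h\<close> and \<open>r\<close> shows that it still comes after
      \<open>h\<close>.\<close>
    obtain r' where r': "r' \<in> S" "q r' < q r" and r'max: "\<And>v. v \<in> S \<Longrightarrow> q v < q r \<Longrightarrow> q v \<le> q r'"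
    proof -
      have "finite {v \<in> S. q v < q r}" "{v \<in> S. q v < q r} \<noteq> {}" using fin wr by auto
      then show ?thesis using finite_has_greatest[of _ q] that by (metis (no_types, lifting) mem_Collect_eq)
    qed
    have hr': "q h < q r'" using r'max[OF wr(1,3)] wr(2) by linarith
    let ?L = "{v \<in> S. q v < q r'}"
    have rest: "v = r' \<or> v = r \<or> q r < q v" if "v \<in> S" "v \<notin> ?L" for v
      using that q_neq[of v r] q_neq[of v r'] r'max[of v] rS r' by (metis (mono_tags, lifting) linorder_neqE_nat mem_Collect_eq not_le)
    \<comment> \<open>The long edge from \<open>h\<close> to \<open>r\<close> leaves \<open>r'\<close> as the only later vertex that the rest of
      \<open>?L\<close> can reach.\<close>
    have cross: "y = r'" if "x \<in> ?L" "x \<noteq> h" "y \<in> S" "y \<notin> ?L" "{x, y} \<in> E" for x y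
    proof (rule ccontr)
      assume "y \<noteq> r'"
      then have y: "q r' < q y" using rest[OF that(3,4)] r'(2) by auto
      have "q x \<noteq> q h" using q_neq that hS by auto
      then consider "q x < q h" | "q h < q x" by linarith
      then show False
      proof cases
        case 1
        then show False
          using strip_orderD[OF strip, of x y h r r' r'] that y hr hr' r' rS hS by auto
      next
        case 2
        then show False
          using strip_orderD[OF strip, of h r x y r' r'] that y hr hr' r' rS hS by auto
      qed
    qed
    \<comment> \<open>For each position of \<open>x\<close> and \<open>x'\<close> relative to
      \<open>h\<close>, two of the edges \<open>{x, r'}\<close>, \<open>{x', r'}\<close>,
      \<open>{h, r}\<close> overlap in more than one step.\<close>
    have cross_unique: "x = x'" if "x \<in> ?L" "x' \<in> ?L" "x \<noteq> h" "x' \<noteq> h" "{x, r'} \<in> E" "{x', r'} \<in> E" for x x'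
    proof -
      have *: False if "x \<in> ?L" "x' \<in> ?L" "x \<noteq> h" "x' \<noteq> h" "{x, r'} \<in> E" "{x', r'} \<in> E" "q x < q x'" for x x'
      proof -
        have "q x \<noteq> q h" "q x' \<noteq> q h" using q_neq that hS by auto
        then consider "q x < q h" "q h < q x'" | "q x < q h" "q x' < q h" | "q h < q x" by linarith
        then show False
        proof cases
          case 1
          then show False
            using strip_orderD[OF strip, of x r' h r x' r'] that hr hr' r' rS hS by auto
        next
          case 2
          then show False
            using strip_orderD[OF strip, of x r' x' r' h h] that hr hr' r' rS hS by auto
        next
          case 3
          then show False
            using strip_orderD[OF strip, of h r x r' r' x'] that hr hr' r' rS hS by auto
        qed
      qed
      show ?thesis using *[of x x'] *[of x' x] that q_neq[of x x'] by (metis (mono_tags, lifting) linorder_neqE_nat mem_Collect_eq)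
    qed
    \<comment> \<open>As the edge from \<open>h\<close> to \<open>r\<close> jumps over
      \<open>r'\<close>, an edge starting at \<open>v\<close> cannot jump over any vertex. So
      \<open>v\<close> has at most one later and two earlier neighbours.\<close>
    have middle: "card (nbrs E S v) \<le> k" if v: "v \<in> S" "q h < q v" "q v < q r'" for v
    proof -
      have "card {u \<in> nbrs E S v. q v < q u} \<le> 1"
      proof -
        have "a = b" if ab: "a \<in> {u \<in> nbrs E S v. q v < q u}" "b \<in> {u \<in> nbrs E S v. q v < q u}" for a b
        proof (rule ccontr)
          assume "a \<noteq> b"
          have *: False if "a \<in> nbrs E S v" "b \<in> nbrs E S v" "q v < q a" "q a < q b" for a b
            using strip_orderD[OF strip, of h r v b r' a] that v hr hr' r' rS hS
            by (auto simp: nbrs_def insert_commute)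
          have "q a \<noteq> q b" using ab q_neq[of a b] \<open>a \<noteq> b\<close> by (auto simp: nbrs_def)
          then show False using *[of a b] *[of b a] ab by (auto simp: neq_iff)
        qed
        then show ?thesis using fin_nbrs[of S v] by (simp add: card_le_Suc0_iff_eq)
      qed
      moreover have "nbrs E S v = {u \<in> nbrs E S v. q u < q v} \<union> {u \<in> nbrs E S v. q v < q u}"
        using q_neq v loopless by (force simp: nbrs_def)
      then have "card (nbrs E S v) \<le> card {u \<in> nbrs E S v. q u < q v} + card {u \<in> nbrs E S v. q v < q u}"
        by (metis card_Un_le)
      ultimately show ?thesis using strip_back_nbrs[OF strip fin v(1)] assms(3) by linarith
    qed
    have L_deg: "card (nbrs E S v) \<le> k" if "v \<in> ?L" "v \<noteq> h" for v
      using that before_h[of v] middle[of v] q_neq[of v h] hS by (auto simp: neq_iff)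
    have hL: "h \<in> ?L" using hS hr' by auto
    have finL: "finite ?L" using fin by auto
    have cL: "card (?L - {h}) + 1 = card ?L" using card_Suc_Diff1[OF finL hL] by simp
    have N_sub: "nbrs E S h \<subseteq> (?L - {h}) \<union> {r', r}"
    proof
      fix u assume u: "u \<in> nbrs E S h"
      then have uS: "u \<in> S" and "u \<noteq> h" using loopless hS by (auto simp: nbrs_def)
      have "q u \<le> q r" using r(2)[of u] u hr(2) by (cases "q h < q u") (auto simp: fwd_def)
      then show "u \<in> (?L - {h}) \<union> {r', r}" using rest[OF uS] \<open>u \<noteq> h\<close> by auto
    qed
    have cardL: "card ((?L - {h}) \<union> {r', r}) = card ?L + 1"
    proof -
      have "card ((?L - {h}) \<union> {r', r}) = card (?L - {h}) + card {r', r}"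
        using finL r' by (intro card_Un_disjoint) auto
      moreover have "card {r', r} = 2" using r' by (auto simp: card_2_iff)
      ultimately show ?thesis using cL by linarith
    qed
    \<comment> \<open>The more than \<open>k\<close> neighbours of \<open>h\<close> fit into a set
      of \<open>card ?L + 1\<close> elements.\<close>
    have "k < card ?L + 1" using card_mono[OF _ N_sub] finL h_deg cardL by simp
    then consider "card ?L = k" | "k < card ?L" by linarith
    then show ?thesis
    proof cases
      case 1
      \<comment> \<open>Delete \<open>r'\<close>. The count is tight, so \<open>h\<close> has
        exactly \<open>k + 1\<close> neighbours and loses one of them. The vertex \<open>h\<close>
        itself stays in the recursion, since \<open>r\<close> is joined to it.\<close>
      let ?B = "insert r' (?L - {h})"
      have BS: "?B \<subseteq> S" using r' by auto
      have "card ?B = card (?L - {h}) + 1" using finL by simp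
      then have cB: "card ?B = k" using cL 1 by simp
      have lt: "card (S - ?B) < card S" using BS fin cB assms(3)
        by (intro psubset_card_mono) auto
      obtain D where D: "D \<subseteq> S - ?B" "k * card D \<le> card (S - ?B)"
          "\<forall>v\<in>(S - ?B) - D. card (nbrs E ((S - ?B) - D) v) \<le> k"
        using less.hyps[OF lt] fin strip_order_subset[OF strip, of "S - ?B"] loopless by auto
      have N_eq: "nbrs E S h = (?L - {h}) \<union> {r', r}"
        using card_subset_eq[OF _ N_sub] card_mono[OF _ N_sub] finL h_deg cardL 1 by auto
      let ?D = "insert r' D"
      have fD: "finite D" using D(1) fin finite_subset by blast
      have "r' \<notin> D" using D(1) by blast
      then have "card ?D = card D + 1" using fD by simp
      moreover have "card (S - ?B) + k = card S"
        using card_Diff_subset[OF finite_subset[OF BS fin] BS] card_mono[OF fin BS] cB by linarith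
      ultimately have "k * card ?D \<le> card S" using D(2) by (simp add: algebra_simps)
      moreover have "card (nbrs E (S - ?D) v) \<le> k" if v: "v \<in> S - ?D" for v
      proof (cases "v = h")
        case True
        have "nbrs E (S - ?D) h \<subseteq> nbrs E S h - {r'}" by (auto simp: nbrs_def)
        then have "card (nbrs E (S - ?D) h) \<le> card (nbrs E S h - {r'})"
          using fin_nbrs[of S] by (intro card_mono) auto
        also have "\<dots> = card ((?L - {h}) \<union> {r', r}) - 1"
          unfolding N_eq using finL by (intro card_Diff_singleton) auto
        also have "\<dots> = k" using cardL 1 by simp
        finally show ?thesis using True by simp
      next
        case False
        show ?thesis
        proof (cases "v \<in> ?L")
          case True
          then show ?thesis using L_deg[OF True False] nbrs_mono[of "S - ?D" S v] by simp
        next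
          case vL: False
          have "nbrs E (S - ?D) v \<subseteq> nbrs E ((S - ?B) - D) v"
            using cross[of _ v] v vL by (auto simp: nbrs_def)
          then have "card (nbrs E (S - ?D) v) \<le> card (nbrs E ((S - ?B) - D) v)"
            by (intro card_mono fin_nbrs) auto
          moreover have "v \<in> (S - ?B) - D" using v vL by auto
          ultimately show ?thesis using D(3) le_trans by blast
        qed
      qed
      ultimately show ?thesis using D(1) r' by (intro exI[of _ ?D] conjI ballI) auto
    next
      case 2
      \<comment> \<open>Delete \<open>h\<close>. At most one other vertex of \<open>?L\<close> is
        joined to \<open>r'\<close>; keeping it out of \<open>?B\<close> leaves at least
        \<open>k\<close> elements there and cuts \<open>?B\<close> off from all vertices outside
        \<open>?L\<close> once \<open>h\<close> is gone.\<close>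
      let ?Q = "{x \<in> ?L. x \<noteq> h \<and> {x, r'} \<in> E}"
      let ?B = "?L - ?Q"
      have fQ: "finite ?Q" using fin by simp
      have "card ?Q \<le> 1" using cross_unique card_le_Suc0_iff_eq[OF fQ] by auto
      moreover have "?Q \<subseteq> ?L" by blast
      note card_Diff_subset[OF fQ this]
      ultimately have cB: "k \<le> card ?B" using 2 by linarith
      have BS: "?B \<subseteq> S" by auto
      have lt: "card (S - ?B) < card S" using fin hS hr'
        by (intro psubset_card_mono) auto
      obtain D where D: "D \<subseteq> S - ?B" "k * card D \<le> card (S - ?B)"
          "\<forall>v\<in>(S - ?B) - D. card (nbrs E ((S - ?B) - D) v) \<le> k"
        using less.hyps[OF lt] fin strip_order_subset[OF strip, of "S - ?B"] loopless by auto
      let ?D = "insert h D"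
      have fD: "finite D" using D(1) fin finite_subset by blast
      have "h \<notin> ?Q" by simp
      then have "h \<notin> D" using D(1) hL by blast
      then have "card ?D = card D + 1" using fD by simp
      moreover have "card (S - ?B) + card ?B = card S"
        using card_Diff_subset[OF finite_subset[OF BS fin] BS] card_mono[OF fin BS] by linarith
      ultimately have "k * card ?D \<le> card S" using D(2) cB by (simp add: algebra_simps)
      moreover have "card (nbrs E (S - ?D) v) \<le> k" if v: "v \<in> S - ?D" for v
      proof (cases "v \<in> ?L")
        case True
        then show ?thesis using L_deg[of v] v nbrs_mono[of "S - ?D" S v] by simp
      next
        case vL: False
        have "nbrs E (S - ?D) v \<subseteq> nbrs E ((S - ?B) - D) v"
          using cross[of _ v] v vL by (auto simp: nbrs_def)
        then have "card (nbrs E (S - ?D) v) \<le> card (nbrs E ((S - ?B) - D) v)"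
          by (intro card_mono fin_nbrs) auto
        moreover have "v \<in> (S - ?B) - D" using v vL by auto
        ultimately show ?thesis using D(3) le_trans by blast
      qed
      ultimately show ?thesis using D(1) hS by (intro exI[of _ ?D]) auto
    qed
  qed
qed

section \<open>Theta curves\<close>

text \<open>The Jordan curve theorem for \<open>c\<close> followed by the reverse of
  \<open>d\<close>.\<close>

lemma Jordan_two_arcs:
  fixes c d :: "real \<Rightarrow> complex"
  assumes "arc c" "arc d" "pathstart c = a" "pathfinish c = b" "pathstart d = a" "pathfinish d = b"
    and "path_image c \<inter> path_image d = {a, b}"
  shows "inside (path_image c \<union> path_image d) \<noteq> {}"
    and "connected (inside (path_image c \<union> path_image d))"
    and "bounded (inside (path_image c \<union> path_image d))"
    and "frontier (inside (path_image c \<union> path_image d)) = path_image c \<union> path_image d"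
    and "connected (outside (path_image c \<union> path_image d))"
proof -
  let ?g = "c +++ reversepath d"
  have "simple_path ?g"
    using assms by (intro simple_path_join_loop) (auto simp: arc_reversepath)
  moreover have "pathfinish ?g = pathstart ?g" "path_image ?g = path_image c \<union> path_image d"
    using assms by (auto simp: path_image_join)
  ultimately show
    "inside (path_image c \<union> path_image d) \<noteq> {}"
    "connected (inside (path_image c \<union> path_image d))"
    "bounded (inside (path_image c \<union> path_image d))"
    "frontier (inside (path_image c \<union> path_image d)) = path_image c \<union> path_image d"
    "connected (outside (path_image c \<union> path_image d))"
    using Jordan_inside_outside[of ?g] by auto
qed

lemma connected_subset_inside:
  fixes S :: "'a::real_normed_vector set"
  assumes "closed S" "connected C" "C \<inter> S = {}" "C \<inter> inside S \<noteq> {}"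
  shows "C \<subseteq> inside S"
proof -
  have "C \<subseteq> inside S \<union> outside S" using assms(3) by auto
  then have "inside S \<inter> C = {} \<or> outside S \<inter> C = {}"
    using assms(1,2) by (intro connectedD) (auto simp: open_inside open_outside)
  then show ?thesis using assms(4) \<open>C \<subseteq> inside S \<union> outside S\<close> by blast
qed

lemma connected_subset_outside:
  fixes S :: "'a::real_normed_vector set"
  assumes "closed S" "connected C" "C \<inter> S = {}" "C \<inter> outside S \<noteq> {}"
  shows "C \<subseteq> outside S"
proof -
  have "C \<subseteq> inside S \<union> outside S" using assms(3) by auto
  moreover have "\<not> C \<subseteq> inside S" using assms(4) inside_Int_outside[of S] by blast
  ultimately show ?thesis using connected_subset_inside[OF assms(1-3)] by blast
qed

lemma arc_interior_nonempty:
  fixes c :: "real \<Rightarrow> 'a::t2_space"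
  assumes "arc c" shows "\<exists>x. x \<in> path_image c - {pathstart c, pathfinish c}"
proof -
  have "c (1/2) \<in> path_image c" by (auto simp: path_image_def)
  moreover have "c (1/2) \<noteq> c 0" "c (1/2) \<noteq> c 1"
    using assms inj_onD[of c "{0..1}" "1/2" 0] inj_onD[of c "{0..1}" "1/2" 1] by (auto simp: arc_def)
  ultimately show ?thesis by (auto simp: pathstart_def pathfinish_def)
qed

text \<open>The inside of the second cycle is connected and misses the first cycle. It reaches the
  outside of the first, because an inner point of \<open>c3\<close> lies in that open set and on the
  frontier of the inside.\<close>

lemma inside_face_subset_outside:
  fixes c1 c2 c3 :: "real \<Rightarrow> complex"
  assumes arcs: "arc c1" "arc c2" "arc c3"
    and ends: "pathstart c1 = a" "pathfinish c1 = b" "pathstart c2 = a" "pathfinish c2 = b"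
      "pathstart c3 = a" "pathfinish c3 = b"
    and int: "path_image c1 \<inter> path_image c2 = {a, b}" "path_image c1 \<inter> path_image c3 = {a, b}"
      "path_image c2 \<inter> path_image c3 = {a, b}"
    and no1: "path_image c1 \<inter> inside (path_image c2 \<union> path_image c3) = {}"
    and no3: "path_image c3 \<inter> inside (path_image c1 \<union> path_image c2) = {}"
  shows "inside (path_image c2 \<union> path_image c3) \<subseteq> outside (path_image c1 \<union> path_image c2)"
proof -
  let ?J = "path_image c1 \<union> path_image c2" and ?K = "path_image c2 \<union> path_image c3"
  have cl: "closed ?J" "closed ?K" using arcs by (auto simp: closed_arc_image)
  obtain x where x: "x \<in> path_image c3" "x \<noteq> a" "x \<noteq> b"
    using arc_interior_nonempty[OF arcs(3)] ends by auto
  have "x \<notin> ?J" using x int by blast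
  then have xo: "x \<in> outside ?J" using x no3 inside_Un_outside[of ?J] by blast
  have "x \<in> closure (inside ?K)"
    using x Jordan_two_arcs(4)[OF arcs(2,3) ends(3-6) int(3)] by (auto simp: frontier_def)
  then have "inside ?K \<inter> outside ?J \<noteq> {}"
    using xo open_outside[OF cl(1)] by (meson open_Int_closure_eq_empty disjoint_iff)
  moreover have "inside ?K \<inter> ?J = {}" using no1 inside_no_overlap[of ?K] by blast
  ultimately show ?thesis
    using connected_subset_outside cl Jordan_two_arcs(2)[OF arcs(2,3) ends(3-6) int(3)] by blast
qed

text \<open>Otherwise a point \<open>p\<close> inside the cycle of \<open>c2\<close> and
  \<open>c3\<close> is outside both cycles through \<open>c1\<close>. Each of these two cycles fails
  to separate \<open>p\<close> from a far point \<open>z\<close>; then neither does their union, and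
  \<open>p\<close> is outside the third cycle as well.\<close>

lemma theta_curve_arc_inside:
  fixes c1 c2 c3 :: "real \<Rightarrow> complex"
  assumes arcs: "arc c1" "arc c2" "arc c3"
    and ends: "pathstart c1 = a" "pathfinish c1 = b" "pathstart c2 = a" "pathfinish c2 = b"
      "pathstart c3 = a" "pathfinish c3 = b"
    and int: "path_image c1 \<inter> path_image c2 = {a, b}" "path_image c1 \<inter> path_image c3 = {a, b}"
      "path_image c2 \<inter> path_image c3 = {a, b}"
  shows "path_image c1 \<inter> inside (path_image c2 \<union> path_image c3) \<noteq> {} \<or>
         path_image c2 \<inter> inside (path_image c1 \<union> path_image c3) \<noteq> {} \<or>
         path_image c3 \<inter> inside (path_image c1 \<union> path_image c2) \<noteq> {}"
proof (rule ccontr)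
  let ?A = "path_image c1" and ?B = "path_image c2" and ?C = "path_image c3"
  assume "\<not> ?thesis"
  then have no: "?A \<inter> inside (?B \<union> ?C) = {}" "?B \<inter> inside (?A \<union> ?C) = {}"
    "?C \<inter> inside (?A \<union> ?B) = {}" by auto
  obtain p where p: "p \<in> inside (?B \<union> ?C)"
    using Jordan_two_arcs(1)[OF arcs(2,3) ends(3-6) int(3)] by auto
  have p1: "p \<in> outside (?A \<union> ?B)"
    using inside_face_subset_outside[OF arcs ends int no(1,3)] p by auto
  have "inside (?C \<union> ?B) \<subseteq> outside (?A \<union> ?C)"
    by (rule inside_face_subset_outside[OF arcs(1,3,2) ends(1,2,5,6,3,4)])
       (use int no in \<open>auto simp: Un_commute Int_commute\<close>)
  then have p2: "p \<in> outside (?A \<union> ?C)" using p by (auto simp: Un_commute)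
  let ?T = "(?A \<union> ?B) \<union> (?A \<union> ?C)"
  have "bounded ?T" using arcs by (simp add: bounded_arc_image)
  then obtain z where "z \<in> outside ?T" using outside_bounded_nonempty by blast
  then have z: "z \<in> outside (?A \<union> ?B)" "z \<in> outside (?A \<union> ?C)" "z \<in> outside (?B \<union> ?C)"
    using outside_mono[of "?A \<union> ?B" ?T] outside_mono[of "?A \<union> ?C" ?T]
      outside_mono[of "?B \<union> ?C" ?T] by auto
  have cc: "connected_component (- (?A \<union> ?B)) p z" "connected_component (- (?A \<union> ?C)) p z"
    unfolding connected_component_def
    using Jordan_two_arcs(5)[OF arcs(1,2) ends(1-4) int(1)] p1 z(1)
      Jordan_two_arcs(5)[OF arcs(1,3) ends(1,2,5,6) int(2)] p2 z(2) outside_no_overlap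
    by (metis disjoint_eq_subset_Compl inf_commute)+
  \<comment> \<open>Janiszewski's theorem requires the two closed sets to meet in a connected set;
    here this is the arc \<open>c1\<close>.\<close>
  have "(?A \<union> ?B) \<inter> (?A \<union> ?C) = ?A" using int by blast
  then have "connected_component (- ?T) p z"
    by (intro Janiszewski cc)
       (use arcs in \<open>simp_all add: compact_Un closed_Un compact_arc_image closed_arc_image connected_arc_image\<close>)
  then have "connected_component (- (?B \<union> ?C)) p z"
    by (rule connected_component_of_subset) auto
  then have "p \<in> outside (?B \<union> ?C)"
    using z(3) outside_same_component connected_component_sym by blast
  then show False using p inside_Int_outside by blast
qed

section \<open>Paths in outerplanar drawings\<close>

text \<open>A connected set with two distinct points has only limit points, and removing finitely
  many points preserves limit points. This recovers the ends of an edge from the location of its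
  inner part.\<close>

lemma closure_arc_endless:
  fixes c :: "real \<Rightarrow> 'a::metric_space"
  assumes "arc c" "x \<in> path_image c"
  shows "x \<in> closure (path_image c - {pathstart c, pathfinish c})"
proof -
  have "pathstart c \<in> path_image c" "pathfinish c \<in> path_image c" "pathstart c \<noteq> pathfinish c"
    using arc_distinct_ends[OF assms(1)] by auto
  then have "x islimpt path_image c"
    using assms by (intro connected_imp_perfect) (auto simp: connected_arc_image)
  then have "x islimpt (path_image c - {pathstart c, pathfinish c}) \<union> {pathstart c, pathfinish c}"
    by (rule islimpt_subset) auto
  then have "x islimpt (path_image c - {pathstart c, pathfinish c})"
    unfolding islimpt_Un by (simp add: islimpt_finite)
  then show ?thesis by (simp add: closure_def)
qed

section \<open>Vertex lists as paths\<close>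

fun list_edges :: "'a list \<Rightarrow> 'a set set" where
  "list_edges [] = {}"
| "list_edges [x] = {}"
| "list_edges (x # y # zs) = insert {x, y} (list_edges (y # zs))"

lemma list_edges_subset: "e \<in> list_edges xs \<Longrightarrow> e \<subseteq> set xs"
  by (induction xs rule: list_edges.induct) auto

lemma list_edges_append: "list_edges (xs @ x # ys) = list_edges (xs @ [x]) \<union> list_edges (x # ys)"
  by (induction xs rule: list_edges.induct) auto

lemma list_edges_rev [simp]: "list_edges (rev xs) = list_edges xs"
proof (induction xs rule: list_edges.induct)
  case (3 x y zs)
  have "list_edges (rev (x # y # zs)) = list_edges (rev zs @ [y]) \<union> {{x, y}}"
    using list_edges_append[of "rev zs" y "[x]"] by (auto simp: insert_commute)
  then show ?case using 3 by simp
qed auto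

text \<open>Paths are written \<open>x # A @ [y]\<close>, with \<open>A\<close> the inner vertices.
  When \<open>A\<close> is nonempty, each edge of the path has an end in \<open>A\<close>, so
  internally disjoint paths share no edge.\<close>

lemma list_edges_meets_middle:
  "A \<noteq> [] \<Longrightarrow> e \<in> list_edges (x # A @ [y]) \<Longrightarrow> e \<inter> set A \<noteq> {}"
  by (induction A arbitrary: x) (auto split: list.splits, force elim: list_edges.elims)

lemma list_edges_disjoint:
  assumes "A \<noteq> []" "set A \<inter> set ws = {}"
  shows "list_edges (x # A @ [y]) \<inter> list_edges ws = {}"
  using list_edges_meets_middle[OF assms(1)] list_edges_subset assms(2) by fastforce

lemma list_edges_covered:
  "v \<in> set xs \<Longrightarrow> 2 \<le> length xs \<Longrightarrow> \<exists>e\<in>list_edges xs. v \<in> e"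
proof (induction xs rule: list_edges.induct)
  case (3 x y zs)
  then show ?case by (cases zs) auto
qed auto

lemma path_graph_neighbours:
  assumes "path_graph W" "{F, A} \<in> edges W" "{F, B} \<in> edges W" "{F, C} \<in> edges W"
  shows "A = B \<or> A = C \<or> B = C"
proof -
  obtain xs where d: "distinct xs" and W: "edges W = {{xs ! i, xs ! Suc i} | i. Suc i < length xs}"
    using assms(1) by (auto simp: path_graph_def)
  have *: "\<exists>i j. i < length xs \<and> j < length xs \<and> F = xs ! i \<and> X = xs ! j \<and> (j = Suc i \<or> i = Suc j)"
    if "{F, X} \<in> edges W" for X
  proof -
    have "{F, X} \<in> {{xs ! i, xs ! Suc i} | i. Suc i < length xs}" using that W by simp
    then obtain k where "Suc k < length xs" "{F, X} = {xs ! k, xs ! Suc k}" by blast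
    then show ?thesis by (metis Suc_lessD doubleton_eq_iff)
  qed
  obtain i a where a: "i < length xs" "a < length xs" "F = xs ! i" "A = xs ! a" "a = Suc i \<or> i = Suc a"
    using *[OF assms(2)] by auto
  obtain i' b where b: "i' < length xs" "b < length xs" "F = xs ! i'" "B = xs ! b" "b = Suc i' \<or> i' = Suc b"
    using *[OF assms(3)] by auto
  obtain i'' c where c: "i'' < length xs" "c < length xs" "F = xs ! i''" "C = xs ! c" "c = Suc i'' \<or> i'' = Suc c"
    using *[OF assms(4)] by auto
  have "i' = i" "i'' = i" using a b c d by (metis nth_eq_iff_index_eq)+
  then have "a = b \<or> a = c \<or> b = c" using a(5) b(5) c(5) by auto
  then show ?thesis using a b c by auto
qed

section \<open>Cycles and chords in an outerplanar drawing\<close>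

locale outer_drawing =
  fixes V :: "'a set" and E :: "'a set set" and p :: "'a \<Rightarrow> complex"
    and \<gamma> :: "'a set \<Rightarrow> real \<Rightarrow> complex"
  assumes simple: "simple_graph (V, E)" and drawing: "outerplanar_drawing (V, E) p \<gamma>"
begin

definition curve :: "'a set set \<Rightarrow> complex set" where
  "curve F = (\<Union>e\<in>F. path_image (\<gamma> e))"

lemma curve_Un: "curve (F \<union> F') = curve F \<union> curve F'"
  by (auto simp: curve_def)

lemma edge_vertices: "e \<in> E \<Longrightarrow> e \<subseteq> V"
  using simple by (auto simp: simple_graph_def)

lemma edge_distinct: "{x, y} \<in> E \<Longrightarrow> x \<noteq> y"
  using simple by (force simp: simple_graph_def)

lemma inj_p: "inj_on p V"
  using drawing by (simp add: outerplanar_drawing_def planar_drawing_def)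

lemma edge_arc: "e \<in> E \<Longrightarrow> arc (\<gamma> e) \<and> {pathstart (\<gamma> e), pathfinish (\<gamma> e)} = p ` e"
  using drawing by (simp add: outerplanar_drawing_def planar_drawing_def)

lemma vertex_on_curve:
  assumes "v \<in> V" "F \<subseteq> E" "p v \<in> curve F"
  shows "v \<in> \<Union>F"
  using assms drawing by (fastforce simp: outerplanar_drawing_def planar_drawing_def curve_def)

lemma vertex_in_curve:
  assumes "F \<subseteq> E" "e \<in> F" "v \<in> e"
  shows "p v \<in> curve F"
proof -
  have "p v \<in> {pathstart (\<gamma> e), pathfinish (\<gamma> e)}" using edge_arc[of e] assms by blast
  then have "p v \<in> path_image (\<gamma> e)" by auto
  then show ?thesis using assms(2) by (auto simp: curve_def)
qed

text \<open>Reads the vertices off the drawn point set, so that edge sets with the same curve cover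
  the same vertices.\<close>

lemma Union_eq_vertices_on_curve:
  assumes "F \<subseteq> E" shows "\<Union>F = {v \<in> V. p v \<in> curve F}"
proof (intro set_eqI iffI)
  fix v assume "v \<in> \<Union>F"
  then obtain e where "e \<in> F" "v \<in> e" by auto
  then show "v \<in> {v \<in> V. p v \<in> curve F}"
    using vertex_in_curve[OF assms] edge_vertices assms by auto
next
  fix v assume "v \<in> {v \<in> V. p v \<in> curve F}"
  then show "v \<in> \<Union>F" using vertex_on_curve assms by auto
qed

lemma curve_Int:
  assumes "F \<subseteq> E" "F' \<subseteq> E" "F \<inter> F' = {}"
  shows "curve F \<inter> curve F' \<subseteq> p ` (\<Union>F \<inter> \<Union>F')"
proof
  fix z assume "z \<in> curve F \<inter> curve F'"
  then obtain e f where ef: "e \<in> F" "f \<in> F'" "z \<in> path_image (\<gamma> e) \<inter> path_image (\<gamma> f)"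
    by (auto simp: curve_def)
  then have "e \<noteq> f" "e \<in> E" "f \<in> E" using assms by auto
  moreover have "\<forall>e\<in>E. \<forall>f\<in>E. e \<noteq> f \<longrightarrow> path_image (\<gamma> e) \<inter> path_image (\<gamma> f) \<subseteq> p ` (e \<inter> f)"
    using drawing by (simp add: outerplanar_drawing_def planar_drawing_def)
  ultimately have "z \<in> p ` (e \<inter> f)" using ef(3) by blast
  then show "z \<in> p ` (\<Union>F \<inter> \<Union>F')" using ef by auto
qed

lemma curve_subset_drawn: "F \<subseteq> E \<Longrightarrow> curve F \<subseteq> drawn_points (V, E) p \<gamma>"
  by (auto simp: curve_def drawn_points_def)

text \<open>Outerplanarity enters here: a vertex is a limit of points of the outer face, all of
  which lie outside the smaller set \<open>J\<close>, whereas \<open>inside J\<close> is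
  open.\<close>

lemma vertex_notin_inside:
  assumes "closed J" "J \<subseteq> drawn_points (V, E) p \<gamma>" "v \<in> V"
  shows "p v \<notin> inside J"
proof -
  have "p v \<in> closure (outside (drawn_points (V, E) p \<gamma>))"
    using drawing assms(3) by (auto simp: outerplanar_drawing_def frontier_def)
  then have "p v \<in> closure (outside J)"
    using closure_mono[OF outside_mono[OF assms(2)]] by blast
  moreover have "inside J \<inter> closure (outside J) = {}"
    using open_inside[OF assms(1)] by (simp add: open_Int_closure_eq_empty)
  ultimately show ?thesis by blast
qed

lemma edge_path:
  assumes "{x, y} \<in> E"
  obtains c where "arc c" "pathstart c = p x" "pathfinish c = p y"
    "path_image c = path_image (\<gamma> {x, y})"
proof (cases "pathstart (\<gamma> {x, y}) = p x")
  case True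
  then show ?thesis using that[of "\<gamma> {x, y}"] edge_arc[OF assms] edge_distinct[OF assms]
    by (auto simp: doubleton_eq_iff)
next
  case False
  then show ?thesis using that[of "reversepath (\<gamma> {x, y})"] edge_arc[OF assms] edge_distinct[OF assms]
    by (auto simp: doubleton_eq_iff arc_reversepath)
qed

lemma list_path:
  assumes "distinct (x # xs @ [y])" "list_edges (x # xs @ [y]) \<subseteq> E"
  obtains c where "arc c" "pathstart c = p x" "pathfinish c = p y"
    "path_image c = curve (list_edges (x # xs @ [y]))"
  using assms
proof (induction xs arbitrary: x thesis)
  case Nil
  then show ?case using edge_path[of x y] by (auto simp: curve_def)
next
  case (Cons z zs)
  obtain c where c: "arc c" "pathstart c = p z" "pathfinish c = p y"
      "path_image c = curve (list_edges (z # zs @ [y]))"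
    using Cons.IH[of z] Cons.prems by auto
  obtain d where d: "arc d" "pathstart d = p x" "pathfinish d = p z"
      "path_image d = curve {{x, z}}"
    using edge_path[of x z] Cons.prems by (auto simp: curve_def)
  have "{x, z} \<notin> list_edges (z # zs @ [y])"
    using list_edges_subset[of "{x, z}" "z # zs @ [y]"] Cons.prems(2) by auto
  then have "path_image d \<inter> path_image c \<subseteq> p ` ({x, z} \<inter> \<Union>(list_edges (z # zs @ [y])))"
    unfolding d c using curve_Int[of "{{x, z}}" "list_edges (z # zs @ [y])"] Cons.prems by auto
  also have "\<dots> \<subseteq> {p z}"
    using list_edges_subset[of _ "z # zs @ [y]"] Cons.prems(2) by fastforce
  finally have "arc (d +++ c)" using c d by (intro arc_join) auto
  moreover have "path_image (d +++ c) = curve (list_edges (x # (z # zs) @ [y]))"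
    using c d by (auto simp: path_image_join curve_def)
  ultimately show ?case using Cons.prems(1)[of "d +++ c"] c d by simp
qed

text \<open>The path without its ends is connected and misses \<open>J\<close>. If it met the inside
  it would lie there entirely, together with a vertex of \<open>A\<close>.\<close>

lemma list_arc_not_inside:
  assumes "distinct (x # A @ [y])" "A \<noteq> []" "list_edges (x # A @ [y]) \<subseteq> E"
    and J: "closed J" "J \<subseteq> drawn_points (V, E) p \<gamma>"
    and int: "curve (list_edges (x # A @ [y])) \<inter> J = {p x, p y}"
  shows "curve (list_edges (x # A @ [y])) \<inter> inside J = {}"
proof (rule ccontr)
  let ?C = "curve (list_edges (x # A @ [y]))"
  assume ne: "?C \<inter> inside J \<noteq> {}"
  obtain c where c: "arc c" "pathstart c = p x" "pathfinish c = p y" "path_image c = ?C"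
    using list_path[OF assms(1,3)] .
  have "connected (?C - {p x, p y})"
    using connected_simple_path_endless[OF arc_imp_simple_path[OF c(1)]] c by simp
  moreover have "(?C - {p x, p y}) \<inter> J = {}" "(?C - {p x, p y}) \<inter> inside J \<noteq> {}"
    using int ne inside_no_overlap[of J] by blast+
  ultimately have sub: "?C - {p x, p y} \<subseteq> inside J"
    using connected_subset_inside J(1) by blast
  obtain a where a: "a \<in> set A" using assms(2) by (cases A) auto
  then obtain e where e: "e \<in> list_edges (x # A @ [y])" "a \<in> e"
    using list_edges_covered[of a "x # A @ [y]"] by auto
  have "p a \<in> ?C" using vertex_in_curve[OF assms(3)] e by auto
  moreover have V: "set (x # A @ [y]) \<subseteq> V"
    using list_edges_covered[of _ "x # A @ [y]"] assms(3) edge_vertices by fastforce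
  moreover have "p a \<noteq> p x" "p a \<noteq> p y" using inj_p a V assms(1) by (auto simp: inj_on_def)
  ultimately have "p a \<in> inside J" using sub by blast
  then show False using vertex_notin_inside[OF J] a V by auto
qed

lemma list_vertices:
  assumes "list_edges xs \<subseteq> E" "2 \<le> length xs" shows "set xs \<subseteq> V"
  using list_edges_covered[OF _ assms(2)] assms(1) edge_vertices by fastforce

lemma list_curves_Int:
  assumes "distinct (x # y # A @ B)" "A \<noteq> []"
    and "list_edges (x # A @ [y]) \<subseteq> E" "list_edges (x # B @ [y]) \<subseteq> E"
  shows "curve (list_edges (x # A @ [y])) \<inter> curve (list_edges (x # B @ [y])) = {p x, p y}"
proof -
  let ?C = "\<lambda>L. curve (list_edges (x # L @ [y]))"
  have ends: "{p x, p y} \<subseteq> ?C L" if "list_edges (x # L @ [y]) \<subseteq> E" for L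
    using list_edges_covered[of x "x # L @ [y]"] list_edges_covered[of y "x # L @ [y]"]
      vertex_in_curve[OF that] by auto
  have "list_edges (x # A @ [y]) \<inter> list_edges (x # B @ [y]) = {}"
    using assms by (intro list_edges_disjoint) auto
  then have "?C A \<inter> ?C B \<subseteq> p ` (\<Union>(list_edges (x # A @ [y])) \<inter> \<Union>(list_edges (x # B @ [y])))"
    by (rule curve_Int[OF assms(3,4)])
  also have "\<dots> \<subseteq> p ` (set (x # A @ [y]) \<inter> set (x # B @ [y]))"
    using list_edges_subset[of _ "x # A @ [y]"] list_edges_subset[of _ "x # B @ [y]"]
    by (intro image_mono Int_mono Union_least)
  also have "set (x # A @ [y]) \<inter> set (x # B @ [y]) = {x, y}" using assms(1) by auto
  finally have "?C A \<inter> ?C B \<subseteq> {p x, p y}" by simp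
  moreover have "{p x, p y} \<subseteq> ?C A" "{p x, p y} \<subseteq> ?C B" using ends assms(3,4) by blast+
  ultimately show ?thesis by blast
qed

text \<open>Of the three arcs of the theta curve, the two with inner vertices cannot enter the
  inside of the cycle formed by the others. An empty \<open>C\<close> gives the case of a
  chord.\<close>

lemma theta_chord_inside:
  assumes dist: "distinct (x # y # A @ B @ C)" and ne: "A \<noteq> []" "B \<noteq> []"
    and E: "list_edges (x # A @ [y]) \<subseteq> E" "list_edges (x # B @ [y]) \<subseteq> E"
      "list_edges (x # C @ [y]) \<subseteq> E"
  shows "curve (list_edges (x # C @ [y])) \<inter>
    inside (curve (list_edges (x # A @ [y]) \<union> list_edges (x # B @ [y]))) \<noteq> {}"
proof -
  let ?C = "\<lambda>L. curve (list_edges (x # L @ [y]))"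
  have path: "\<exists>c. arc c \<and> pathstart c = p x \<and> pathfinish c = p y \<and> path_image c = ?C L"
    if "distinct (x # L @ [y])" "list_edges (x # L @ [y]) \<subseteq> E" for L
    using list_path[OF that] by metis
  obtain a where a: "arc a" "pathstart a = p x" "pathfinish a = p y" "path_image a = ?C A"
    using path[of A] dist E by auto
  obtain b where b: "arc b" "pathstart b = p x" "pathfinish b = p y" "path_image b = ?C B"
    using path[of B] dist E by auto
  obtain c where c: "arc c" "pathstart c = p x" "pathfinish c = p y" "path_image c = ?C C"
    using path[of C] dist E by auto
  have int: "?C A \<inter> ?C B = {p x, p y}" "?C A \<inter> ?C C = {p x, p y}" "?C B \<inter> ?C C = {p x, p y}"
    using dist ne E by (intro list_curves_Int; auto)+
  have closed: "closed (?C A)" "closed (?C B)" "closed (?C C)"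
    using closed_arc_image a b c by metis+
  have drawn: "?C A \<subseteq> drawn_points (V, E) p \<gamma>" "?C B \<subseteq> drawn_points (V, E) p \<gamma>"
      "?C C \<subseteq> drawn_points (V, E) p \<gamma>"
    using curve_subset_drawn E by auto
  have "?C A \<inter> inside (?C B \<union> ?C C) = {}"
    using dist ne E closed drawn int by (intro list_arc_not_inside) auto
  moreover have "?C B \<inter> inside (?C A \<union> ?C C) = {}"
    using dist ne E closed drawn int by (intro list_arc_not_inside) auto
  ultimately have "?C C \<inter> inside (?C A \<union> ?C B) \<noteq> {}"
    using theta_curve_arc_inside[OF a(1) b(1) c(1) a(2,3) b(2,3) c(2,3)] int
    unfolding a(4) b(4) c(4) by blast
  then show ?thesis by (simp add: curve_Un)
qed

text \<open>The path through \<open>C\<close> would have to meet the inside of the other two, but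
  its inner vertices forbid that.\<close>

lemma no_theta:
  assumes "distinct (x # y # A @ B @ C)" "A \<noteq> []" "B \<noteq> []" "C \<noteq> []"
    and "list_edges (x # A @ [y]) \<subseteq> E" "list_edges (x # B @ [y]) \<subseteq> E"
      "list_edges (x # C @ [y]) \<subseteq> E"
  shows False
proof -
  let ?C = "\<lambda>L. curve (list_edges (x # L @ [y]))"
  have int: "?C A \<inter> ?C C = {p x, p y}" "?C B \<inter> ?C C = {p x, p y}"
    using assms by (intro list_curves_Int; auto)+
  have "closed (?C L)" if "distinct (x # L @ [y])" "list_edges (x # L @ [y]) \<subseteq> E" for L
    using list_path[OF that] by (metis closed_arc_image)
  then have "closed (?C A)" "closed (?C B)" using assms by auto
  then have "?C C \<inter> inside (?C A \<union> ?C B) = {}"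
    using assms int curve_subset_drawn by (intro list_arc_not_inside) auto
  then show False using theta_chord_inside[OF assms(1-3,5-7)] by (simp add: curve_Un)
qed

text \<open>The chord \<open>{x, y}\<close> is inside too and splits the inside of the cycle into
  two open parts. The inner part of \<open>{b, d}\<close> stays in one of them, so \<open>b\<close>
  or \<open>d\<close> is in the closure of the part bounded by the path not containing it. But no
  vertex is inside that part, and this one is not on its boundary.\<close>

lemma inside_chord_not_crossing:
  assumes dist: "distinct (x # y # A @ B)" and bd_in: "b \<in> set A" "d \<in> set B"
    and E: "list_edges (x # A @ [y]) \<subseteq> E" "list_edges (x # B @ [y]) \<subseteq> E"
      "{x, y} \<in> E" "{b, d} \<in> E"
    and f_in: "curve {{b, d}} \<inter>
      inside (curve (list_edges (x # A @ [y]) \<union> list_edges (x # B @ [y]))) \<noteq> {}"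
  shows False
proof -
  let ?F = "list_edges (x # A @ [y])" and ?G = "list_edges (x # B @ [y])"
  let ?e = "curve {{x, y}}" and ?f = "curve {{b, d}}"
  have ne: "A \<noteq> []" "B \<noteq> []" using bd_in by auto
  have e_in: "?e \<inter> inside (curve (?F \<union> ?G)) \<noteq> {}"
    using theta_chord_inside[of x y A B "[]"] dist ne E by simp
  have dAB: "distinct (x # A @ [y])" "distinct (x # B @ [y])" using dist by auto
  obtain a where a: "arc a" "pathstart a = p x" "pathfinish a = p y" "path_image a = curve ?F"
    using list_path[OF dAB(1) E(1)] .
  obtain g where g: "arc g" "pathstart g = p x" "pathfinish g = p y" "path_image g = curve ?G"
    using list_path[OF dAB(2) E(2)] .
  obtain e where e: "arc e" "pathstart e = p x" "pathfinish e = p y" "path_image e = ?e"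
    using edge_path[OF E(3)] by (auto simp: curve_def)
  obtain f where f: "arc f" "pathstart f = p b" "pathfinish f = p d" "path_image f = ?f"
    using edge_path[OF E(4)] by (auto simp: curve_def)
  have V: "set (x # A @ [y]) \<subseteq> V" "set (x # B @ [y]) \<subseteq> V"
    using list_vertices[OF E(1)] list_vertices[OF E(2)] by simp_all
  have neq: "p x \<noteq> p y" using inj_p V dist by (auto simp: inj_on_def)
  have int: "curve ?F \<inter> curve ?G = {p x, p y}" "curve ?F \<inter> ?e = {p x, p y}" "curve ?G \<inter> ?e = {p x, p y}"
    using list_curves_Int[of x y A B] list_curves_Int[of x y A "[]"] list_curves_Int[of x y B "[]"]
      dist ne E by auto
  let ?IA = "inside (curve ?F \<union> ?e)" and ?IB = "inside (curve ?G \<union> ?e)"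
  obtain disj: "?IA \<inter> ?IB = {}"
    and un: "?IA \<union> ?IB \<union> (?e - {p x, p y}) = inside (curve ?F \<union> curve ?G)"
    using split_inside_simple_closed_curve[OF arc_imp_simple_path[OF a(1)] a(2,3)
        arc_imp_simple_path[OF g(1)] g(2,3) arc_imp_simple_path[OF e(1)] e(2,3) neq,
        unfolded a(4) g(4) e(4), OF int e_in[unfolded curve_Un]] .
  have cl: "closed (curve ?F)" "closed (curve ?G)" "closed ?e"
    using closed_arc_image a g e by metis+
  have drawn: "curve ?F \<subseteq> drawn_points (V, E) p \<gamma>" "curve ?G \<subseteq> drawn_points (V, E) p \<gamma>"
      "?e \<subseteq> drawn_points (V, E) p \<gamma>"
    using curve_subset_drawn E by auto
  let ?f' = "?f - {p b, p d}"
  have "connected ?f'" using connected_simple_path_endless[OF arc_imp_simple_path[OF f(1)]] f by simp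
  have "{b, d} \<notin> ?F \<union> ?G"
    using list_edges_subset[of "{b, d}" "x # A @ [y]"] list_edges_subset[of "{b, d}" "x # B @ [y]"]
      dist bd_in by auto
  then have "?f \<inter> curve (?F \<union> ?G) \<subseteq> {p b, p d}"
    using curve_Int[of "{{b, d}}" "?F \<union> ?G"] E by auto
  moreover have "?f \<inter> ?e = {}"
    using curve_Int[of "{{b, d}}" "{{x, y}}"] E dist bd_in by (auto simp: doubleton_eq_iff)
  ultimately have f': "?f' \<inter> (curve ?F \<union> curve ?G) = {}" "?f' \<inter> ?e = {}"
    by (auto simp: curve_Un)
  have bd: "p b \<in> ?f" "p d \<in> ?f" using f pathstart_in_path_image pathfinish_in_path_image by metis+
  have "p b \<in> curve ?F" "p d \<in> curve ?G"
    using list_edges_covered[of b "x # A @ [y]"] list_edges_covered[of d "x # B @ [y]"]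
      vertex_in_curve E(1,2) bd_in by auto
  then have "?f' \<inter> inside (curve ?F \<union> curve ?G) \<noteq> {}"
    using f_in inside_no_overlap[of "curve ?F \<union> curve ?G"] unfolding curve_Un by blast
  then have "?f' \<subseteq> inside (curve ?F \<union> curve ?G)"
    using connected_subset_inside[OF closed_Un[OF cl(1,2)] \<open>connected ?f'\<close> f'(1)] by blast
  then have sub: "?f' \<subseteq> ?IA \<union> ?IB" using f'(2) un by blast
  have "?IA \<inter> ?f' = {} \<or> ?IB \<inter> ?f' = {}"
    using sub disj cl \<open>connected ?f'\<close> by (intro connectedD) (auto intro: open_inside)
  then have "?f' \<subseteq> ?IA \<or> ?f' \<subseteq> ?IB" using sub by blast
  then have "p d \<in> closure ?IA \<or> p b \<in> closure ?IB"
    using closure_arc_endless[OF f(1), unfolded f(2-4)] bd closure_mono by blast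
  then have "p d \<in> curve ?F \<union> ?e \<union> ?IA \<or> p b \<in> curve ?G \<union> ?e \<union> ?IB"
    using closure_inside_subset[OF closed_Un[OF cl(1,3)]] closure_inside_subset[OF closed_Un[OF cl(2,3)]]
    by blast
  moreover have "p d \<notin> ?IA" "p b \<notin> ?IB"
    using cl drawn V bd_in by (intro vertex_notin_inside; auto)+
  ultimately have "p d \<in> curve ?F \<union> ?e \<or> p b \<in> curve ?G \<union> ?e" by blast
  moreover have "d \<in> V" "b \<in> V" using V bd_in by auto
  ultimately have "d \<in> \<Union>(?F \<union> {{x, y}}) \<or> b \<in> \<Union>(?G \<union> {{x, y}})"
    using vertex_on_curve[of d "?F \<union> {{x, y}}", unfolded curve_Un]
      vertex_on_curve[of b "?G \<union> {{x, y}}", unfolded curve_Un] E by blast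
  moreover have "\<Union>?F \<subseteq> set (x # A @ [y])" "\<Union>?G \<subseteq> set (x # B @ [y])"
    using list_edges_subset by fast+
  ultimately show False using dist bd_in by auto
qed

lemma no_crossing_chords:
  assumes dist: "distinct (x # y # (A1 @ b # A2) @ (B1 @ d # B2))"
    and E: "list_edges (x # (A1 @ b # A2) @ [y]) \<subseteq> E" "list_edges (x # (B1 @ d # B2) @ [y]) \<subseteq> E"
      "{x, y} \<in> E" "{b, d} \<in> E"
  shows False
proof -
  let ?A = "A1 @ b # A2" and ?B = "B1 @ d # B2"
  let ?F = "list_edges (x # ?A @ [y])" and ?G = "list_edges (x # ?B @ [y])"
  have split: "?F = list_edges (x # A1 @ [b]) \<union> list_edges (b # A2 @ [y])"
     "?G = list_edges (x # B1 @ [d]) \<union> list_edges (d # B2 @ [y])"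
    using list_edges_append[of "x # A1" b "A2 @ [y]"] list_edges_append[of "x # B1" d "B2 @ [y]"] by auto
  \<comment> \<open>The same cycle as two paths from \<open>b\<close> to \<open>d\<close>, through
    \<open>x\<close> and through \<open>y\<close>. Thus \<open>{b, d}\<close> is a chord in the
    sense of \<open>theta_chord_inside\<close> and lies inside.\<close>
  let ?X = "rev A1 @ x # B1" and ?Y = "A2 @ y # rev B2"
  have "list_edges (b # ?X @ [d]) = list_edges (rev (x # A1 @ [b])) \<union> list_edges (x # B1 @ [d])"
    using list_edges_append[of "b # rev A1" x "B1 @ [d]"] by simp
  moreover have "list_edges (b # ?Y @ [d]) = list_edges (b # A2 @ [y]) \<union> list_edges (rev (d # B2 @ [y]))"
    using list_edges_append[of "b # A2" y "rev B2 @ [d]"] by simp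
  ultimately have XY: "list_edges (b # ?X @ [d]) = list_edges (x # A1 @ [b]) \<union> list_edges (x # B1 @ [d])"
      "list_edges (b # ?Y @ [d]) = list_edges (b # A2 @ [y]) \<union> list_edges (d # B2 @ [y])"
    by (simp_all only: list_edges_rev)
  have f_in: "curve {{b, d}} \<inter> inside (curve (?F \<union> ?G)) \<noteq> {}"
  proof -
    have "curve (list_edges (b # [] @ [d])) \<inter>
        inside (curve (list_edges (b # ?X @ [d]) \<union> list_edges (b # ?Y @ [d]))) \<noteq> {}"
      by (rule theta_chord_inside) (use dist E split XY in auto)
    moreover have "list_edges (b # ?X @ [d]) \<union> list_edges (b # ?Y @ [d]) = ?F \<union> ?G"
      unfolding XY split by auto
    ultimately show ?thesis by simp
  qed
  show False
    by (rule inside_chord_not_crossing[OF dist _ _ E f_in]) auto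
qed

section \<open>Triangles as vertices of the weak dual\<close>

definition triangle :: "'a \<Rightarrow> 'a \<Rightarrow> 'a \<Rightarrow> 'a set set" where
  "triangle x y z = {{x, y}, {y, z}, {x, z}}"

text \<open>No vertex is inside a triangle. An edge meeting the inside would have both ends on the
  triangle, hence be one of its sides. So the inside avoids the whole drawing.\<close>

lemma triangle_face:
  assumes T: "triangle x y z \<subseteq> E"
  shows "inside (curve (triangle x y z)) \<in> internal_faces (V, E) p \<gamma>"
    and "frontier (inside (curve (triangle x y z))) = curve (triangle x y z)"
proof -
  let ?J = "curve (triangle x y z)" and ?D = "drawn_points (V, E) p \<gamma>"
  have E: "{x, y} \<in> E" "{y, z} \<in> E" "{x, z} \<in> E" using T by (auto simp: triangle_def)
  have dist: "distinct [x, y, z]" using E edge_distinct by auto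
  have V: "x \<in> V" "y \<in> V" "z \<in> V" using E edge_vertices by auto
  have eq: "?J = curve (list_edges (x # [z] @ [y])) \<union> curve (list_edges (x # [] @ [y]))"
    by (auto simp: curve_def triangle_def insert_commute)
  have dist': "distinct (x # [z] @ [y])" "distinct (x # [] @ [y])" using dist by auto
  have E': "list_edges (x # [z] @ [y]) \<subseteq> E" "list_edges (x # [] @ [y]) \<subseteq> E"
    using E by (auto simp: insert_commute)
  obtain c where c: "arc c" "pathstart c = p x" "pathfinish c = p y"
      "path_image c = curve (list_edges (x # [z] @ [y]))"
    using list_path[OF dist'(1) E'(1)] .
  obtain d where d: "arc d" "pathstart d = p x" "pathfinish d = p y"
      "path_image d = curve (list_edges (x # [] @ [y]))"
    using list_path[OF dist'(2) E'(2)] .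
  have "path_image c \<inter> path_image d = {p x, p y}"
    unfolding c(4) d(4) using list_curves_Int[of x y "[z]" "[]"] dist E' by auto
  note J = Jordan_two_arcs[OF c(1) d(1) c(2,3) d(2,3) this, unfolded c(4) d(4), folded eq]
  show "frontier (inside ?J) = ?J" by (rule J(4))
  have closed: "closed ?J" using J(4) frontier_closed by metis
  have drawn: "?J \<subseteq> ?D" by (rule curve_subset_drawn[OF T])
  have out: "p v \<notin> inside ?J" if "v \<in> V" for v
    by (rule vertex_notin_inside[OF closed drawn that])
  have edge_out: "path_image (\<gamma> e) \<inter> inside ?J = {}" if e: "e \<in> E" for e
  proof (cases "e \<in> triangle x y z")
    case True
    then have "path_image (\<gamma> e) \<subseteq> ?J" by (auto simp: curve_def)
    then show ?thesis using inside_no_overlap[of ?J] by blast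
  next
    case False
    obtain u v where uv: "e = {u, v}" "u \<noteq> v" "u \<in> V" "v \<in> V"
      using e simple by (auto simp: simple_graph_def card_2_iff)
    obtain g where g: "arc g" "pathstart g = p u" "pathfinish g = p v" "path_image g = path_image (\<gamma> e)"
      using edge_path[of u v] e uv(1) by metis
    have "curve {e} \<inter> ?J \<subseteq> p ` (e \<inter> {x, y, z})"
      using curve_Int[of "{e}" "triangle x y z"] False T e by (auto simp: triangle_def)
    then have int: "path_image g \<inter> ?J \<subseteq> p ` (e \<inter> {x, y, z})"
      using g(4) by (simp add: curve_def)
    show ?thesis
    proof (rule ccontr)
      assume "path_image (\<gamma> e) \<inter> inside ?J \<noteq> {}"
      then have "(path_image g - {p u, p v}) \<inter> inside ?J \<noteq> {}" using out uv g(4) by auto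
      moreover have "connected (path_image g - {p u, p v})"
        using connected_simple_path_endless[OF arc_imp_simple_path[OF g(1)]] g by simp
      moreover have "(path_image g - {p u, p v}) \<inter> ?J = {}" using int uv(1) by auto
      ultimately have "path_image g - {p u, p v} \<subseteq> inside ?J"
        using connected_subset_inside[OF closed] by blast
      then have "p w \<in> closure (inside ?J)" if "p w \<in> path_image g" for w
        using closure_arc_endless[OF g(1) that, unfolded g(2,3)] closure_mono by blast
      then have "p u \<in> ?J \<union> inside ?J" "p v \<in> ?J \<union> inside ?J"
        using closure_inside_subset[OF closed] g pathstart_in_path_image[of g] pathfinish_in_path_image[of g]
        by auto
      then have "p u \<in> ?J" "p v \<in> ?J" using out uv by auto
      then have "u \<in> {x, y, z}" "v \<in> {x, y, z}"
        using vertex_on_curve[OF _ T] uv by (auto simp: triangle_def)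
      then show False using uv False by (auto simp: triangle_def insert_commute)
    qed
  qed
  have "inside ?J \<subseteq> - ?D" using out edge_out by (auto simp: drawn_points_def)
  \<comment> \<open>A larger connected set off the drawing would avoid the triangle itself, and so
    could not leave its inside.\<close>
  moreover have "C = inside ?J" if "inside ?J \<subseteq> C" "C \<subseteq> - ?D" "connected C" for C
    using connected_subset_inside[OF closed that(3)] that drawn J(1) by blast
  ultimately have "inside ?J \<in> components (- ?D)"
    unfolding in_components_maximal using J(1,2) by blast
  then show "inside ?J \<in> internal_faces (V, E) p \<gamma>"
    using J(3) by (simp add: internal_faces_def)
qed

text \<open>Equal faces have equal frontiers, and the frontier determines the three corners.\<close>

lemma triangle_face_neq:
  assumes "triangle a b c \<subseteq> E" "triangle x y z \<subseteq> E" "{a, b, c} \<noteq> {x, y, z}"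
  shows "inside (curve (triangle a b c)) \<noteq> inside (curve (triangle x y z))"
proof
  assume "inside (curve (triangle a b c)) = inside (curve (triangle x y z))"
  then have eq: "curve (triangle a b c) = curve (triangle x y z)"
    using triangle_face(2)[OF assms(1)] triangle_face(2)[OF assms(2)] by metis
  have "\<Union>(triangle a b c) = \<Union>(triangle x y z)"
    using Union_eq_vertices_on_curve[OF assms(1)] Union_eq_vertices_on_curve[OF assms(2)] eq by simp
  then have "{a, b, c} = {x, y, z}" by (simp add: triangle_def insert_commute)
  then show False using assms(3) by simp
qed

lemma weak_dual_adjacent:
  assumes T: "triangle a b c \<subseteq> E" "triangle a b x \<subseteq> E" and "x \<noteq> c"
  shows "{inside (curve (triangle a b c)), inside (curve (triangle a b x))}
    \<in> edges (weak_dual (V, E) p \<gamma>)"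
proof -
  have "x \<noteq> a" "x \<noteq> b" "{a, b} \<in> E" using T edge_distinct by (auto simp: triangle_def)
  then have "inside (curve (triangle a b c)) \<noteq> inside (curve (triangle a b x))"
    using assms by (intro triangle_face_neq) auto
  moreover have "path_image (\<gamma> {a, b}) \<subseteq> curve (triangle a b c) \<inter> curve (triangle a b x)"
    by (auto simp: curve_def triangle_def)
  ultimately show ?thesis
    using triangle_face[OF T(1)] triangle_face[OF T(2)] \<open>{a, b} \<in> E\<close>
    unfolding weak_dual_def snd_conv mem_Collect_eq fst_conv by metis
qed

text \<open>The face of \<open>a\<close>, \<open>b\<close>, \<open>c\<close> would have three
  distinct neighbours in a path.\<close>

lemma triangle_not_branching:
  assumes "path_graph (weak_dual (V, E) p \<gamma>)"
    and "triangle a b c \<subseteq> E" "triangle a b x \<subseteq> E" "triangle b c y \<subseteq> E" "triangle a c z \<subseteq> E"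
    and "x \<noteq> c" "y \<noteq> a" "z \<noteq> b"
  shows False
proof -
  let ?I = "\<lambda>u v w. inside (curve (triangle u v w))"
  have rot: "triangle a b c = triangle b c a" "triangle a b c = triangle a c b"
    by (auto simp: triangle_def insert_commute)
  have ne: "x \<noteq> a" "x \<noteq> b" "y \<noteq> b" "y \<noteq> c" "z \<noteq> a" "z \<noteq> c" "a \<noteq> b" "a \<noteq> c" "b \<noteq> c"
    using assms(2-5) edge_distinct by (auto simp: triangle_def)
  have "{?I a b c, ?I a b x} \<in> edges (weak_dual (V, E) p \<gamma>)"
    using weak_dual_adjacent[of a b c x] assms by simp
  moreover have "{?I a b c, ?I b c y} \<in> edges (weak_dual (V, E) p \<gamma>)"
    using weak_dual_adjacent[of b c a y] assms by (simp add: rot(1)[symmetric])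
  moreover have "{?I a b c, ?I a c z} \<in> edges (weak_dual (V, E) p \<gamma>)"
    using weak_dual_adjacent[of a c b z] assms by (simp add: rot(2)[symmetric])
  moreover have "?I a b x \<noteq> ?I b c y" "?I a b x \<noteq> ?I a c z" "?I b c y \<noteq> ?I a c z"
    using assms ne by (intro triangle_face_neq; auto)+
  ultimately show False using path_graph_neighbours[OF assms(1)] by blast
qed

end

section \<open>Noncrossing orders give outerplanar drawings\<close>

text \<open>A one-page book embedding: with the vertices along a line, or equally on a circle, in
  the order of \<open>f\<close>, the edges can be drawn as noncrossing chords.\<close>

definition noncrossing :: "('a \<Rightarrow> nat) \<Rightarrow> 'a set set \<Rightarrow> bool" where
  "noncrossing f E \<longleftrightarrow> (\<forall>a b c d. {a, c} \<in> E \<longrightarrow> {b, d} \<in> E \<longrightarrow>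
     f a < f b \<longrightarrow> f b < f c \<longrightarrow> f c < f d \<longrightarrow> False)"

text \<open>A convex curve: the chords run above it, so every vertex can be reached from
  below.\<close>

definition parabola :: "nat \<Rightarrow> complex" where
  "parabola t = Complex (real t) ((real t)\<^sup>2)"

lemma parabola_simps [simp]: "Re (parabola t) = real t" "Im (parabola t) = (real t)\<^sup>2"
  by (simp_all add: parabola_def)

text \<open>Measured from the parabola instead of the axis, a chord becomes a quadratic function
  with roots at its ends.\<close>

lemma parabola_chord:
  assumes "z \<in> closed_segment (parabola s) (parabola t)" "s < t"
  shows "real s \<le> Re z" "Re z \<le> real t" "Im z - (Re z)\<^sup>2 = (Re z - real s) * (real t - Re z)"
proof -
  obtain u where u: "0 \<le> u" "u \<le> 1" "z = (1 - u) *\<^sub>R parabola s + u *\<^sub>R parabola t"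
    using assms(1) by (auto simp: in_segment)
  have re: "Re z = (1 - u) * real s + u * real t" and im: "Im z = (1 - u) * (real s)\<^sup>2 + u * (real t)\<^sup>2"
    by (simp_all add: u(3))
  have d: "Re z = real s + u * (real t - real s)" "real t = Re z + (1 - u) * (real t - real s)"
    by (simp_all add: re algebra_simps)
  have "0 \<le> u * (real t - real s)" "0 \<le> (1 - u) * (real t - real s)" using u assms(2) by auto
  then show "real s \<le> Re z" "Re z \<le> real t" using d by linarith+
  show "Im z - (Re z)\<^sup>2 = (Re z - real s) * (real t - Re z)"
    unfolding re im by (simp add: power2_eq_square algebra_simps)
qed

text \<open>The difference of the two heights is a sum of two nonnegative products, so both products
  vanish.\<close>

lemma parabola_nested_chords:
  fixes x :: real
  assumes "s \<le> s'" "t' \<le> t" "s' \<le> x" "x \<le> t'" "(s, t) \<noteq> (s', t')"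
    and eq: "(x - s) * (t - x) = (x - s') * (t' - x)"
  shows "(x = s \<or> x = t) \<and> (x = s' \<or> x = t')"
proof -
  have "(s' - s) * (t - x) + (x - s') * (t - t') = 0" using eq by (simp add: algebra_simps)
  moreover have "0 \<le> (s' - s) * (t - x)" "0 \<le> (x - s') * (t - t')" using assms by auto
  ultimately have "(s' - s) * (t - x) = 0" "(x - s') * (t - t') = 0" by linarith+
  then show ?thesis using assms by auto
qed

text \<open>Intervals that do not cross are nested or have at most an end in common.\<close>

lemma parabola_chords_meet:
  fixes x :: real
  assumes "s \<le> x" "x \<le> t" "s' \<le> x" "x \<le> t'" "(s, t) \<noteq> (s', t')"
    and "\<not> (s < s' \<and> s' < t \<and> t < t')" "\<not> (s' < s \<and> s < t' \<and> t' < t)"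
    and eq: "(x - s) * (t - x) = (x - s') * (t' - x)"
  shows "(x = s \<or> x = t) \<and> (x = s' \<or> x = t')"
proof -
  consider "t \<le> s'" | "t' \<le> s" | "s \<le> s'" "t' \<le> t" | "s' \<le> s" "t \<le> t'"
    using assms(6,7) by linarith
  then show ?thesis
  proof cases
    case 3
    then show ?thesis using parabola_nested_chords[of s s' t' t x] assms by auto
  next
    case 4
    then show ?thesis using parabola_nested_chords[of s' s t t' x] assms by auto
  qed (use assms in linarith)+
qed

text \<open>The vertical ray going down from \<open>z\<close> is connected, unbounded and disjoint
  from \<open>D\<close>.\<close>

lemma below_parabola_outside:
  assumes "D \<subseteq> {z. (Re z)\<^sup>2 \<le> Im z}" "Im z < (Re z)\<^sup>2"
  shows "z \<in> outside D"
proof -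
  let ?R = "{w. Re w = Re z} \<inter> {w. Im w \<le> Im z}"
  have "convex ?R" by (auto simp: convex_def convex_bound_le simp flip: distrib_right)
  moreover have "?R \<subseteq> - D" using assms by fastforce
  ultimately have sub: "?R \<subseteq> connected_component_set (- D) z"
    by (intro connected_component_maximal) (auto intro: convex_connected)
  have "\<not> bounded ?R"
  proof
    assume "bounded ?R"
    then obtain B where B: "\<And>w. w \<in> ?R \<Longrightarrow> norm w \<le> B" by (auto simp: bounded_iff)
    let ?w = "Complex (Re z) (Im z - \<bar>Im z\<bar> - \<bar>B\<bar> - 1)"
    have "norm ?w \<le> B" by (rule B) auto
    then show False using abs_Im_le_cmod[of ?w] by simp
  qed
  then show ?thesis using bounded_subset[OF _ sub] assms(1) by (auto simp: outside)
qed

lemma simple_graph_edgeE: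
  assumes "simple_graph (V, E)" "e \<in> E"
  obtains a b where "e = {a, b}" "a \<noteq> b" "a \<in> V" "b \<in> V"
proof -
  have "e \<subseteq> V" "card e = 2" using assms by (auto simp: simple_graph_def)
  then show ?thesis using that by (auto simp: card_2_iff)
qed

lemma noncrossing_outerplanar:
  assumes simple: "simple_graph (V, E)" and inj: "inj_on f V" and nc: "noncrossing f E"
  shows "outerplanar (V, E)"
proof -
  define p where "p = (\<lambda>v. parabola (f v))"
  \<comment> \<open>\<open>Min\<close> and \<open>Max\<close> give the unordered edge a direction,
    from left to right.\<close>
  define \<gamma> where "\<gamma> = (\<lambda>e. linepath (parabola (Min (f ` e))) (parabola (Max (f ` e))))"
  have ends: "\<exists>u v. e = {u, v} \<and> u \<in> V \<and> v \<in> V \<and> f u < f v \<and> \<gamma> e = linepath (p u) (p v)"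
    if "e \<in> E" for e
  proof -
    obtain a b where ab: "e = {a, b}" "a \<noteq> b" "a \<in> V" "b \<in> V"
      using simple_graph_edgeE[OF simple \<open>e \<in> E\<close>] .
    then have "f a \<noteq> f b" using inj by (auto simp: inj_on_def)
    then consider "f a < f b" | "f b < f a" by linarith
    then show ?thesis
    proof cases
      case 1
      then show ?thesis using ab by (intro exI[of _ a] exI[of _ b]) (auto simp: \<gamma>_def p_def)
    next
      case 2
      then show ?thesis using ab
        by (intro exI[of _ b] exI[of _ a]) (auto simp: \<gamma>_def p_def)
    qed
  qed
  have inj_p: "inj_on p V"
  proof (rule inj_onI)
    fix x y assume "x \<in> V" "y \<in> V" "p x = p y"
    then have "Re (p x) = Re (p y)" by simp
    then show "x = y" using inj \<open>x \<in> V\<close> \<open>y \<in> V\<close> by (auto simp: p_def inj_on_def)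
  qed
  have arcs: "arc (\<gamma> e) \<and> {pathstart (\<gamma> e), pathfinish (\<gamma> e)} = p ` e" if "e \<in> E" for e
  proof -
    obtain u v where uv: "e = {u, v}" "u \<in> V" "v \<in> V" "f u < f v" "\<gamma> e = linepath (p u) (p v)"
      using ends[OF \<open>e \<in> E\<close>] by auto
    have "p u \<noteq> p v" using inj_p uv by (auto simp: inj_on_def)
    then show ?thesis using uv by auto
  qed
  have vert: "v \<in> e" if "e \<in> E" "v \<in> V" "p v \<in> path_image (\<gamma> e)" for e v
  proof -
    obtain a b where ab: "e = {a, b}" "a \<in> V" "b \<in> V" "f a < f b" "\<gamma> e = linepath (p a) (p b)"
      using ends[OF \<open>e \<in> E\<close>] by auto
    then have "p v \<in> closed_segment (parabola (f a)) (parabola (f b))" using that(3) by (simp add: p_def)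
    from parabola_chord(3)[OF this ab(4)] have "real (f v) = real (f a) \<or> real (f v) = real (f b)"
      by (auto simp: p_def)
    then show ?thesis using inj ab that(2) by (auto simp: inj_on_def)
  qed
  have meet: "path_image (\<gamma> e) \<inter> path_image (\<gamma> e') \<subseteq> p ` (e \<inter> e')" if "e \<in> E" "e' \<in> E" "e \<noteq> e'" for e e'
  proof
    fix z assume z: "z \<in> path_image (\<gamma> e) \<inter> path_image (\<gamma> e')"
    obtain u v where uv: "e = {u, v}" "u \<in> V" "v \<in> V" "f u < f v" "\<gamma> e = linepath (p u) (p v)"
      using ends[OF \<open>e \<in> E\<close>] by auto
    obtain u' v' where uv': "e' = {u', v'}" "u' \<in> V" "v' \<in> V" "f u' < f v'" "\<gamma> e' = linepath (p u') (p v')"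
      using ends[OF \<open>e' \<in> E\<close>] by auto
    have "z \<in> closed_segment (parabola (f u)) (parabola (f v))"
      "z \<in> closed_segment (parabola (f u')) (parabola (f v'))"
      using z uv uv' by (simp_all add: p_def)
    note chord = parabola_chord[OF this(1) uv(4)] parabola_chord[OF this(2) uv'(4)]
    have "(real (f u), real (f v)) \<noteq> (real (f u'), real (f v'))"
      using that(3) uv uv' inj by (auto simp: inj_on_def)
    moreover have "\<not> (real (f u) < real (f u') \<and> real (f u') < real (f v) \<and> real (f v) < real (f v'))"
      using nc that uv(1) uv'(1) unfolding noncrossing_def of_nat_less_iff by metis
    moreover have "\<not> (real (f u') < real (f u) \<and> real (f u) < real (f v') \<and> real (f v') < real (f v))"
      using nc that uv(1) uv'(1) unfolding noncrossing_def of_nat_less_iff by metis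
    ultimately have x: "(Re z = real (f u) \<or> Re z = real (f v)) \<and> (Re z = real (f u') \<or> Re z = real (f v'))"
      using chord by (intro parabola_chords_meet) auto
    then have "Im z = (Re z)\<^sup>2" using chord(3) by auto
    then have z_eq: "z = p w" if "Re z = real (f w)" for w
      using that by (simp add: p_def complex_eq_iff)
    obtain w where w: "w \<in> e" "w \<in> V" "Re z = real (f w)" using x uv by auto
    obtain w' where w': "w' \<in> e'" "w' \<in> V" "Re z = real (f w')" using x uv' by auto
    have "w = w'" using w w' inj by (auto simp: inj_on_def)
    then show "z \<in> p ` (e \<inter> e')" using z_eq[OF w(3)] w w' by auto
  qed
  let ?D = "drawn_points (V, E) p \<gamma>"
  have above: "?D \<subseteq> {z. (Re z)\<^sup>2 \<le> Im z}"
  proof -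
    have "(Re z)\<^sup>2 \<le> Im z" if e: "e \<in> E" and z: "z \<in> path_image (\<gamma> e)" for e z
    proof -
      obtain u v where uv: "e = {u, v}" "u \<in> V" "v \<in> V" "f u < f v" "\<gamma> e = linepath (p u) (p v)"
        using ends[OF e] by auto
      have "z \<in> closed_segment (parabola (f u)) (parabola (f v))" using z uv by (simp add: p_def)
      note chord = parabola_chord[OF this uv(4)]
      then have "0 \<le> (Re z - real (f u)) * (real (f v) - Re z)" by simp
      then show ?thesis using chord(3) by linarith
    qed
    then show ?thesis by (auto simp: drawn_points_def p_def)
  qed
  have "p v \<in> frontier (outside ?D)" if "v \<in> V" for v
  proof -
    have "p v \<in> ?D" using that by (simp add: drawn_points_def)
    then have "p v \<notin> outside ?D" using outside_no_overlap by blast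
    then have "p v \<notin> interior (outside ?D)" using interior_subset by blast
    \<comment> \<open>Points straight below a vertex lie below the parabola, hence in the outer
      face, arbitrarily close to the vertex.\<close>
    moreover have "\<exists>y\<in>outside ?D. dist y (p v) < \<epsilon>" if "\<epsilon> > 0" for \<epsilon>
    proof (rule bexI)
      show "dist (p v - \<i> * complex_of_real (\<epsilon> / 2)) (p v) < \<epsilon>"
        using that by (simp add: dist_norm norm_mult)
      show "p v - \<i> * complex_of_real (\<epsilon> / 2) \<in> outside ?D"
        by (rule below_parabola_outside[OF above]) (use that in \<open>simp add: p_def\<close>)
    qed
    then have "p v \<in> closure (outside ?D)" by (simp add: closure_approachable)
    ultimately show ?thesis by (simp add: frontier_def)
  qed
  then have "outerplanar_drawing (V, E) p \<gamma>"
    unfolding outerplanar_drawing_def planar_drawing_def using inj_p arcs vert meet by auto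
  then show ?thesis using simple by (auto simp: outerplanar_def)
qed

text \<open>Adding the edge destroys outerplanarity, so by \<open>noncrossing_outerplanar\<close> it
  creates a crossing; as \<open>E\<close> has none, the new edge takes part in it.\<close>

lemma maximal_outerplanar_nonedge_crossed:
  assumes max: "maximal_outerplanar (V, E)" and inj: "inj_on f V" and nc: "noncrossing f E"
    and uv: "u \<in> V" "v \<in> V" "f u < f v" "{u, v} \<notin> E"
  shows "\<exists>b d. b \<in> V \<and> d \<in> V \<and> {b, d} \<in> E \<and> f u < f b \<and> f b < f v \<and> (f d < f u \<or> f v < f d)"
proof -
  have simple: "simple_graph (V, E)" using max by (simp add: maximal_outerplanar_def outerplanar_def)
  have "u \<noteq> v" using uv by auto
  then have "\<not> outerplanar (V, insert {u, v} E)" using max uv by (simp add: maximal_outerplanar_def)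
  moreover have "simple_graph (V, insert {u, v} E)" using simple uv \<open>u \<noteq> v\<close> by (simp add: simple_graph_def)
  ultimately have "\<not> noncrossing f (insert {u, v} E)" using noncrossing_outerplanar inj by blast
  then obtain a b c d where h: "{a, c} \<in> insert {u, v} E" "{b, d} \<in> insert {u, v} E"
      "f a < f b" "f b < f c" "f c < f d"
    by (auto simp: noncrossing_def)
  have V: "x \<in> V" "y \<in> V" if "{x, y} \<in> E" for x y using simple that by (auto simp: simple_graph_def)
  have ends: "x = u \<and> y = v" if "{x, y} = {u, v}" "f x < f y" for x y
    using that uv(3) by (auto simp: doubleton_eq_iff)
  consider "{a, c} = {u, v}" "{b, d} = {u, v}" | "{a, c} = {u, v}" "{b, d} \<in> E"
    | "{a, c} \<in> E" "{b, d} = {u, v}" | "{a, c} \<in> E" "{b, d} \<in> E" using h by blast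
  then show ?thesis
  proof cases
    case 1
    then show ?thesis using ends[of a c] ends[of b d] h by auto
  next
    case 2
    then have "a = u" "c = v" using ends[of a c] h by auto
    then show ?thesis using h V[OF 2(2)] 2 by blast
  next
    case 3
    then have "b = u" "d = v" using ends[of b d] h by auto
    then show ?thesis using h V[OF 3(1)] 3 by (metis insert_commute)
  next
    case 4
    then show ?thesis using nc h unfolding noncrossing_def by blast
  qed
qed

section \<open>Outerplanar graphs have noncrossing orders\<close>

text \<open>Crossing depends only on the cyclic order, so the vertices before \<open>x\<close> may
  be moved behind all others.\<close>

lemma noncrossing_rotate:
  assumes "finite V" and EV: "\<forall>e\<in>E. e \<subseteq> V" and inj: "inj_on f V" and nc: "noncrossing f E"
  shows "\<exists>g. inj_on g V \<and> noncrossing g E \<and> (\<forall>v\<in>V. g x \<le> g v) \<and>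
    (\<forall>u\<in>V. \<forall>v\<in>V. f u < f x \<longrightarrow> f x \<le> f v \<longrightarrow> g v < g u) \<and>
    (\<forall>u\<in>V. \<forall>v\<in>V. (f u < f x \<longleftrightarrow> f v < f x) \<longrightarrow> (g u < g v \<longleftrightarrow> f u < f v))"
proof -
  obtain M where M: "\<And>v. v \<in> V \<Longrightarrow> f v < M"
    using finite_nat_set_iff_bounded[of "f ` V"] assms(1) by auto
  \<comment> \<open>\<open>M\<close> moves the early vertices behind the others. As \<open>x\<close>
    may lie outside \<open>V\<close>, the summand \<open>f x\<close> secures that \<open>g x\<close>
    is still a lower bound.\<close>
  define g where "g = (\<lambda>v. if f v < f x then f v + M + f x else f v)"
  have "inj_on g V"
    using inj M unfolding inj_on_def g_def by (smt (verit) add_lessD1 add_right_cancel less_irrefl not_add_less2)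
  moreover have "noncrossing g E"
    unfolding noncrossing_def
  proof (intro allI impI)
    fix a b c d assume h: "{a, c} \<in> E" "{b, d} \<in> E" "g a < g b" "g b < g c" "g c < g d"
    have "f a < M" "f b < M" "f c < M" "f d < M" using EV h(1,2) M by auto
    \<comment> \<open>These are the four cyclic shifts of the order of the four ends.\<close>
    then have "(f a < f b \<and> f b < f c \<and> f c < f d) \<or> (f d < f a \<and> f a < f b \<and> f b < f c) \<or>
      (f c < f d \<and> f d < f a \<and> f a < f b) \<or> (f b < f c \<and> f c < f d \<and> f d < f a)"
      using h(3-5) unfolding g_def by (auto split: if_splits)
    moreover have "{c, a} \<in> E" "{d, b} \<in> E" using h by (simp_all add: insert_commute)
    ultimately show False using nc h(1,2) unfolding noncrossing_def by blast
  qed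
  moreover have "g x \<le> g v" if "v \<in> V" for v by (auto simp: g_def)
  moreover have "g v < g u" if "u \<in> V" "v \<in> V" "f u < f x" "f x \<le> f v" for u v
    using that M[of v] by (auto simp: g_def)
  moreover have "g u < g v \<longleftrightarrow> f u < f v" if "f u < f x \<longleftrightarrow> f v < f x" for u v
    using that by (auto simp: g_def)
  ultimately show ?thesis by blast
qed

text \<open>Both orders are rotated to begin at \<open>x\<close>, and \<open>V2\<close> is put
  behind \<open>V1\<close>. Only \<open>x\<close> can be a vertex of \<open>V2\<close> with a value
  below \<open>M\<close>, so an edge within \<open>V1\<close> and one within \<open>V2\<close>
  cannot alternate.\<close>

lemma noncrossing_glue:
  assumes fin: "finite V1" "finite V2" and x: "V1 \<inter> V2 \<subseteq> {x}"
    and EV: "\<And>a b. {a, b} \<in> E \<Longrightarrow> {a, b} \<subseteq> V1 \<or> {a, b} \<subseteq> V2"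
    and 1: "inj_on f1 V1" "noncrossing f1 {e \<in> E. e \<subseteq> V1}"
    and 2: "inj_on f2 V2" "noncrossing f2 {e \<in> E. e \<subseteq> V2}"
  shows "\<exists>f :: 'a \<Rightarrow> nat. inj_on f (V1 \<union> V2) \<and> noncrossing f E"
proof -
  obtain g1 where g1: "inj_on g1 V1" "noncrossing g1 {e \<in> E. e \<subseteq> V1}" "\<And>v. v \<in> V1 \<Longrightarrow> g1 x \<le> g1 v"
    using noncrossing_rotate[OF fin(1) _ 1, of x] by auto
  obtain g2 where g2: "inj_on g2 V2" "noncrossing g2 {e \<in> E. e \<subseteq> V2}" "\<And>v. v \<in> V2 \<Longrightarrow> g2 x \<le> g2 v"
    using noncrossing_rotate[OF fin(2) _ 2, of x] by auto
  obtain M where M: "\<And>v. v \<in> V1 \<Longrightarrow> g1 v < M"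
    using finite_nat_set_iff_bounded[of "g1 ` V1"] fin(1) by auto
  define f where "f = (\<lambda>v. if v \<in> V1 then g1 v else M + g2 v)"
  \<comment> \<open>If \<open>x\<close> is shared, it gets its value from \<open>g1\<close> and
    moves before the rest of \<open>V2\<close>; it was already first there.\<close>
  have lt2: "f a < f b \<longleftrightarrow> g2 a < g2 b" if "a \<in> V2" "b \<in> V2" for a b
  proof -
    have "a = x \<or> a \<notin> V1" "b = x \<or> b \<notin> V1" using x that by auto
    moreover have "g2 v \<noteq> g2 x" if "v \<in> V2" "v \<noteq> x" "x \<in> V2" for v
      using that g2(1) by (auto simp: inj_on_def)
    then have "g2 x < g2 v" if "v \<in> V2" "v \<noteq> x" "x \<in> V2" for v
      using that g2(3)[of v] by (metis le_neq_implies_less)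
    ultimately show ?thesis using that M[of x] g2(3)
      by (cases "a = x"; cases "b = x") (auto simp: f_def trans_less_add1 not_less le_add1 less_imp_le dest: leD)
  qed
  have lt1: "f a < f b \<longleftrightarrow> g1 a < g1 b" if "a \<in> V1" "b \<in> V1" for a b using that by (simp add: f_def)
  have 12: "f a < f b" if "a \<in> V1" "b \<in> V2" "b \<noteq> x" for a b
    using that x M[of a] by (auto simp: f_def)
  have xmin: "f x \<le> f v" if "x \<in> V1 \<inter> V2" "v \<in> V1 \<union> V2" for v
    using that g1(3)[of v] M[of x] by (auto simp: f_def)
  have "inj_on f (V1 \<union> V2)"
  proof (rule inj_onI, rule ccontr)
    fix a b assume ab: "a \<in> V1 \<union> V2" "b \<in> V1 \<union> V2" "f a = f b" "a \<noteq> b"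
    then show False
      using g1(1) g2(1) M[of a] M[of b] unfolding inj_on_def f_def
      by (auto split: if_splits)
  qed
  moreover have "noncrossing f E"
    unfolding noncrossing_def
  proof (intro allI impI)
    fix a b c d assume h: "{a, c} \<in> E" "{b, d} \<in> E" "f a < f b" "f b < f c" "f c < f d"
    consider "{a, c} \<subseteq> V1" "{b, d} \<subseteq> V1" | "{a, c} \<subseteq> V2" "{b, d} \<subseteq> V2"
      | "{a, c} \<subseteq> V1" "{b, d} \<subseteq> V2" | "{a, c} \<subseteq> V2" "{b, d} \<subseteq> V1"
      using EV[OF h(1)] EV[OF h(2)] by auto
    then show False
    proof cases
      case 1
      then have "g1 a < g1 b" "g1 b < g1 c" "g1 c < g1 d" using h lt1 by auto
      moreover have "{a, c} \<in> {e \<in> E. e \<subseteq> V1}" "{b, d} \<in> {e \<in> E. e \<subseteq> V1}" using h 1 by auto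
      ultimately show False using g1(2) unfolding noncrossing_def by blast
    next
      case 2
      then have "g2 a < g2 b" "g2 b < g2 c" "g2 c < g2 d" using h lt2 by auto
      moreover have "{a, c} \<in> {e \<in> E. e \<subseteq> V2}" "{b, d} \<in> {e \<in> E. e \<subseteq> V2}" using h 2 by auto
      ultimately show False using g2(2) unfolding noncrossing_def by blast
    next
      case 3
      then have "b = x" using 12[of c b] h by force
      show False
      proof (cases "x \<in> V1")
        case True
        then show False using xmin[of a] 3 h \<open>b = x\<close> by force
      next
        case False
        then show False using M[of c] 3 h \<open>b = x\<close> by (auto simp: f_def)
      qed
    next
      case 4
      then have "c = x" using 12[of d c] h by force
      show False
      proof (cases "x \<in> V1")
        case True
        then show False using xmin[of b] 4 h \<open>c = x\<close> by force
      next
        case False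
        then show False using M[of d] 4 h \<open>c = x\<close> by (auto simp: f_def)
      qed
    qed
  qed
  ultimately show ?thesis by blast
qed

text \<open>With fewer drawn points the outer face only grows, so the remaining vertices stay on its
  boundary.\<close>

lemma outerplanar_induced:
  assumes "outerplanar (V, E)" "W \<subseteq> V"
  shows "outerplanar (W, {e \<in> E. e \<subseteq> W})"
proof -
  obtain p \<gamma> where s: "simple_graph (V, E)" and d: "outerplanar_drawing (V, E) p \<gamma>"
    using assms(1) by (auto simp: outerplanar_def)
  let ?F = "{e \<in> E. e \<subseteq> W}"
  have "simple_graph (W, ?F)" using s assms(2) by (auto simp: simple_graph_def intro: finite_subset)
  moreover have "planar_drawing (W, ?F) p \<gamma>"
    using d assms(2) unfolding outerplanar_drawing_def planar_drawing_def
    by (auto intro: inj_on_subset)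
  moreover have "p v \<in> frontier (outside (drawn_points (W, ?F) p \<gamma>))" if "v \<in> W" for v
  proof -
    have "drawn_points (W, ?F) p \<gamma> \<subseteq> drawn_points (V, E) p \<gamma>"
      using assms(2) by (auto simp: drawn_points_def)
    then have "closure (outside (drawn_points (V, E) p \<gamma>)) \<subseteq> closure (outside (drawn_points (W, ?F) p \<gamma>))"
      by (intro closure_mono outside_mono)
    moreover have "p v \<in> closure (outside (drawn_points (V, E) p \<gamma>))"
      using d assms(2) that by (auto simp: outerplanar_drawing_def frontier_def)
    moreover have "p v \<notin> outside (drawn_points (W, ?F) p \<gamma>)"
    proof -
      have "p v \<in> drawn_points (W, ?F) p \<gamma>" using that by (simp add: drawn_points_def)
      then show ?thesis using outside_no_overlap by blast
    qed
    then have "p v \<notin> interior (outside (drawn_points (W, ?F) p \<gamma>))" using interior_subset by blast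
    ultimately show ?thesis by (auto simp: frontier_def)
  qed
  ultimately show ?thesis by (auto simp: outerplanar_def outerplanar_drawing_def)
qed

section \<open>Cycles and separations\<close>

definition is_cycle :: "'a set set \<Rightarrow> 'a list \<Rightarrow> bool" where
  "is_cycle E cs \<longleftrightarrow> distinct cs \<and> 3 \<le> length cs \<and> list_edges (cs @ [hd cs]) \<subseteq> E"

lemma is_cycle_rotate:
  assumes "is_cycle E (A @ x # B)" shows "is_cycle E (x # B @ A)"
proof (cases A)
  case Nil
  then show ?thesis using assms by simp
next
  case (Cons a A')
  have "list_edges (A @ x # B @ [a]) = list_edges (A @ [x]) \<union> list_edges (x # B @ [a])"
    using list_edges_append[of A x "B @ [a]"] by simp
  moreover have "list_edges (x # B @ A @ [x]) = list_edges (x # B @ [a]) \<union> list_edges (A @ [x])"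
    using list_edges_append[of "x # B" a "A' @ [x]"] Cons by simp
  ultimately show ?thesis using assms Cons by (auto simp: is_cycle_def)
qed

text \<open>Reversing the second half presents both halves as paths from \<open>x\<close> to
  \<open>y\<close>, the form used for theta graphs.\<close>

lemma is_cycle_split:
  assumes "is_cycle E (x # A @ y # B)"
  shows "list_edges (x # A @ [y]) \<subseteq> E" "list_edges (y # B @ [x]) \<subseteq> E" "list_edges (x # rev B @ [y]) \<subseteq> E"
proof -
  have "list_edges (x # A @ y # B @ [x]) \<subseteq> E" using assms by (simp add: is_cycle_def)
  then show *: "list_edges (x # A @ [y]) \<subseteq> E" "list_edges (y # B @ [x]) \<subseteq> E"
    using list_edges_append[of "x # A" y "B @ [x]"] by auto
  show "list_edges (x # rev B @ [y]) \<subseteq> E" using *(2) list_edges_rev[of "y # B @ [x]"] by simp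
qed

lemma is_cycleI:
  assumes "distinct (x # A @ y # B)" "A \<noteq> [] \<or> B \<noteq> []"
    and "list_edges (x # A @ [y]) \<subseteq> E" "list_edges (y # B @ [x]) \<subseteq> E"
  shows "is_cycle E (x # A @ y # B)"
  using assms list_edges_append[of "x # A" y "B @ [x]"] by (cases A; cases B) (auto simp: is_cycle_def)

text \<open>Turns a walk avoiding \<open>C\<close> into a path: on returning to a visited vertex,
  the list is cut back to it.\<close>

lemma list_connects:
  assumes "(a, b) \<in> {(u, v). {u, v} \<in> E \<and> u \<notin> C \<and> v \<notin> C}\<^sup>*" "a \<notin> C"
  shows "\<exists>P. distinct P \<and> P \<noteq> [] \<and> hd P = a \<and> last P = b \<and> list_edges P \<subseteq> E \<and> set P \<inter> C = {}"
  using assms(1)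
proof induction
  case base
  then show ?case using assms(2) by (intro exI[of _ "[a]"]) auto
next
  case (step y z)
  then obtain P where P: "distinct P" "P \<noteq> []" "hd P = a" "last P = y" "list_edges P \<subseteq> E" "set P \<inter> C = {}"
    by auto
  show ?case
  proof (cases "z \<in> set P")
    case True
    then obtain A B where AB: "P = A @ z # B" by (meson split_list)
    then show ?thesis using P list_edges_append[of A z B]
      by (intro exI[of _ "A @ [z]"]) (auto simp: hd_append)
  next
    case False
    obtain Q where Q: "P = Q @ [y]" using P(2,4) by (metis append_butlast_last_id)
    then have "list_edges (P @ [z]) \<subseteq> E" using P step(2) list_edges_append[of Q y "[z]"] by auto
    then show ?thesis using False P step(2) by (intro exI[of _ "P @ [z]"]) auto
  qed
qed

text \<open>A separation of order at most one, by a cut vertex \<open>x\<close> or by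
  disconnection.\<close>

definition separation :: "'a set \<Rightarrow> 'a set set \<Rightarrow> 'a set \<Rightarrow> 'a set \<Rightarrow> bool" where
  "separation V E A B \<longleftrightarrow> A \<union> B = V \<and> A \<noteq> V \<and> B \<noteq> V \<and> (\<exists>x. A \<inter> B \<subseteq> {x}) \<and>
     (\<forall>a b. {a, b} \<in> E \<longrightarrow> {a, b} \<subseteq> A \<or> {a, b} \<subseteq> B)"

text \<open>Otherwise \<open>v\<close> and its only possible neighbour form one side of a
  separation; this side is proper because there are three vertices.\<close>

lemma two_neighbours:
  assumes s: "simple_graph (V, E)" and "3 \<le> card V" and nosep: "\<And>A B. \<not> separation V E A B" and v: "v \<in> V"
  shows "\<exists>a b. a \<noteq> b \<and> {v, a} \<in> E \<and> {v, b} \<in> E"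
proof (rule ccontr)
  assume no: "\<not> ?thesis"
  let ?N = "{u. {v, u} \<in> E}"
  have "?N \<subseteq> {u}" if "u \<in> ?N" for u using no that by blast
  then obtain x where x: "?N \<subseteq> {x}" by blast
  have NV: "?N \<subseteq> V - {v}" using s by (auto simp: simple_graph_def)
  have "card (insert v ?N) \<le> card {v, x}" using x by (intro card_mono) auto
  also have "\<dots> \<le> 2" by (simp add: card_insert_if)
  finally have "insert v ?N \<noteq> V" using assms(2) by auto
  moreover have "V - {v} \<noteq> V" using v by auto
  moreover have "insert v ?N \<union> (V - {v}) = V" using NV v by auto
  moreover have "insert v ?N \<inter> (V - {v}) \<subseteq> {x}" using x by auto
  moreover have "{a, b} \<subseteq> insert v ?N \<or> {a, b} \<subseteq> V - {v}" if ab: "{a, b} \<in> E" for a b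
  proof -
    have "{a, b} \<subseteq> V" using s ab by (auto simp: simple_graph_def)
    then show ?thesis using ab by (cases "a = v"; cases "b = v") (auto simp: insert_commute)
  qed
  ultimately have "separation V E (insert v ?N) (V - {v})" unfolding separation_def by blast
  then show False using nosep by blast
qed

lemma distinct_list_max:
  assumes "finite V" "P xs" "\<And>ys. P ys \<Longrightarrow> distinct ys \<and> set ys \<subseteq> V"
  shows "\<exists>ys. P ys \<and> (\<forall>zs. P zs \<longrightarrow> length zs \<le> length ys)"
proof -
  have "length ys < Suc (card V)" if "P ys" for ys
    using assms(3)[OF that] assms(1) by (metis card_mono distinct_card less_Suc_eq_le)
  then show ?thesis using ex_has_greatest_nat[of P xs length "Suc (card V)"] assms(2) by blast
qed

text \<open>All neighbours of the first vertex \<open>v\<close> of a longest path lie on it, and one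
  that is not the next vertex closes a cycle.\<close>

lemma exists_cycle:
  assumes s: "simple_graph (V, E)" and "3 \<le> card V" and nosep: "\<And>A B. \<not> separation V E A B"
  shows "\<exists>cs. is_cycle E cs"
proof -
  have fin: "finite V" using s by (simp add: simple_graph_def)
  have "V \<noteq> {}" using assms(2) by auto
  then obtain v0 where "v0 \<in> V" by auto
  let ?P = "\<lambda>xs. distinct xs \<and> xs \<noteq> [] \<and> set xs \<subseteq> V \<and> list_edges xs \<subseteq> E"
  obtain xs where xs: "?P xs" and max: "\<And>ys. ?P ys \<Longrightarrow> length ys \<le> length xs"
    using distinct_list_max[of V ?P "[v0]"] fin \<open>v0 \<in> V\<close> by auto
  obtain v ws where ws: "xs = v # ws" using xs by (cases xs) auto
  have in_ws: "u \<in> set ws" if "{v, u} \<in> E" for u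
  proof (rule ccontr)
    assume "u \<notin> set ws"
    moreover have "u \<noteq> v" "u \<in> V" using s that by (auto simp: simple_graph_def)
    ultimately have "?P (u # xs)" using xs ws that by (auto simp: insert_commute)
    then have "length (u # xs) \<le> length xs" by (rule max)
    then show False by simp
  qed
  obtain a b where ab: "a \<noteq> b" "{v, a} \<in> E" "{v, b} \<in> E"
    using two_neighbours[OF assms, of v] xs ws by auto
  obtain w where w: "w \<noteq> hd ws" "{v, w} \<in> E" using ab by metis
  obtain A B where AB: "ws = A @ w # B" using in_ws[OF w(2)] by (meson split_list)
  have "A \<noteq> []" using AB w(1) by auto
  have "list_edges (v # A @ [w]) \<subseteq> E" using xs ws AB list_edges_append[of "v # A" w B] by auto
  then have "is_cycle E (v # A @ w # [])"
    using \<open>A \<noteq> []\<close> xs ws AB w(2) by (intro is_cycleI) (auto simp: insert_commute)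
  then show ?thesis by blast
qed

section \<open>Hamiltonian cycles in outerplanar drawings\<close>

context outer_drawing
begin

lemma hamiltonian_cycle:
  assumes "3 \<le> card V" and nosep: "\<And>A B. \<not> separation V E A B"
  shows "\<exists>cs. is_cycle E cs \<and> set cs = V"
proof -
  have fin: "finite V" using simple by (simp add: simple_graph_def)
  obtain cs0 where cs0: "is_cycle E cs0" using exists_cycle[OF simple assms] by auto
  have sub: "distinct ys \<and> set ys \<subseteq> V" if "is_cycle E ys" for ys
    using list_vertices[of "ys @ [hd ys]"] that by (auto simp: is_cycle_def)
  obtain cs where cs: "is_cycle E cs" and max: "\<And>ys. is_cycle E ys \<Longrightarrow> length ys \<le> length cs"
    using distinct_list_max[of V "is_cycle E", OF fin cs0 sub] by auto
  have "set cs = V"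
  proof (rule ccontr)
    assume "set cs \<noteq> V"
    then obtain v where v: "v \<in> V" "v \<notin> set cs" using sub[OF cs] by auto
    define R where "R = {(u, v). {u, v} \<in> E \<and> u \<notin> set cs \<and> v \<notin> set cs}"
    \<comment> \<open>\<open>K\<close> is the component of \<open>v\<close> off the longest cycle,
      and \<open>A\<close> is the set of its attachments on the cycle. A single attachment would be
      a cut vertex.\<close>
    define K where "K = R\<^sup>* `` {v}"
    define A where "A = {c \<in> set cs. \<exists>u\<in>K. {u, c} \<in> E}"
    have "u \<in> V \<and> u \<notin> set cs" if "(v, u) \<in> R\<^sup>*" for u
      using that by (induction rule: rtrancl_induct) (use v edge_vertices in \<open>auto simp: R_def\<close>)
    then have K: "K \<subseteq> V" "K \<inter> set cs = {}" by (auto simp: K_def)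
    have vK: "v \<in> K" by (simp add: K_def)
    have A: "A \<subseteq> set cs" "A \<subseteq> V" using sub[OF cs] by (auto simp: A_def)
    have AK: "b \<in> K \<union> A" if "a \<in> K" "{a, b} \<in> E" for a b
    proof (cases "b \<in> set cs")
      case False
      then have "(a, b) \<in> R" using that K by (auto simp: R_def)
      then show ?thesis using that(1) by (auto simp: K_def intro: rtrancl_into_rtrancl)
    qed (use that in \<open>auto simp: A_def\<close>)
    have "\<not> A \<subseteq> {x}" for x
    proof
      assume Ax: "A \<subseteq> {x}"
      have "(K \<union> A) \<union> (V - K) = V" using K(1) A(2) by blast
      moreover have "V - K \<noteq> V" using v(1) vK by blast
      moreover have "K \<union> A \<noteq> V"
      proof
        assume "K \<union> A = V"
        then have "set cs \<subseteq> {x}" using K(2) Ax sub[OF cs] by blast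
        then have "card (set cs) \<le> 1" using card_mono[of "{x}" "set cs"] by simp
        then show False using cs by (simp add: is_cycle_def distinct_card)
      qed
      moreover have "(K \<union> A) \<inter> (V - K) \<subseteq> {x}" using Ax by blast
      moreover have "{a, b} \<subseteq> K \<union> A \<or> {a, b} \<subseteq> V - K" if ab: "{a, b} \<in> E" for a b
      proof -
        have "{b, a} \<in> E" using ab by (simp add: insert_commute)
        then show ?thesis using AK[of a b] AK[of b a] ab edge_vertices[OF ab] by blast
      qed
      ultimately have "separation V E (K \<union> A) (V - K)" unfolding separation_def by blast
      then show False using nosep by blast
    qed
    then obtain x y where xy: "x \<in> A" "y \<in> A" "x \<noteq> y" by (metis insertI1 subsetI singletonD)
    then obtain a b where ab: "(v, a) \<in> R\<^sup>*" "{a, x} \<in> E" "(v, b) \<in> R\<^sup>*" "{b, y} \<in> E"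
      by (auto simp: A_def K_def)
    have "sym R" by (auto simp: sym_def R_def insert_commute)
    then have "(a, b) \<in> R\<^sup>*" using ab by (meson rtrancl_trans sym_rtrancl symE)
    moreover have "a \<notin> set cs" using ab(1) K(2) by (auto simp: K_def)
    ultimately obtain P where P: "distinct P" "P \<noteq> []" "hd P = a" "last P = b" "list_edges P \<subseteq> E"
        "set P \<inter> set cs = {}"
      using list_connects[of a b E "set cs", folded R_def] by blast
    obtain C D where "cs = C @ x # D" using xy(1) A(1) by (meson split_list subsetD)
    then have rot: "is_cycle E (x # D @ C)" "set (x # D @ C) = set cs" "length (x # D @ C) = length cs"
      using is_cycle_rotate cs by auto
    have "y \<in> set (D @ C)" using xy A(1) rot(2) by auto
    then obtain A' B' where AB': "D @ C = A' @ y # B'" by (meson split_list)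
    have cyc: "is_cycle E (x # A' @ y # B')" and len: "length (x # A' @ y # B') = length cs"
      and set: "set (x # A' @ y # B') = set cs"
      using rot AB' by auto
    have dist: "distinct (x # A' @ y # B')" using cyc by (simp add: is_cycle_def)
    have dP: "set P \<inter> set (x # A' @ y # B') = {}" using P(6) set by simp
    have path: "list_edges (x # P @ [y]) \<subseteq> E"
    proof -
      obtain Q where Q: "P = Q @ [b]" using P(2,4) by (metis append_butlast_last_id)
      have "list_edges (P @ [y]) \<subseteq> E" using P(5) ab(4) Q list_edges_append[of Q b "[y]"] by auto
      moreover obtain Q' where "P = a # Q'" using P(2,3) by (cases P) auto
      ultimately show ?thesis using ab(2) by (auto simp: insert_commute)
    qed
    note split = is_cycle_split[OF cyc]
    show False
    \<comment> \<open>If \<open>x\<close> and \<open>y\<close> are not consecutive on the cycle, its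
      two halves and \<open>P\<close> form a theta graph. Otherwise \<open>P\<close> can replace the
      edge between them, giving a longer cycle.\<close>
    proof (cases "A' \<noteq> [] \<and> B' \<noteq> []")
      case True
      show False
        by (rule no_theta[of x y A' "rev B'" P]) (use True dist dP P path split in auto)
    next
      case False
      then show False
      proof (cases "A' = []")
        case True
        then have "is_cycle E (x # P @ y # B')"
          using dist dP P path split by (intro is_cycleI) auto
        then show False using max[of "x # P @ y # B'"] len True P(2) by (cases P) auto
      next
        case nA: False
        then have "B' = []" using False by simp
        have "list_edges (y # rev P @ [x]) \<subseteq> E"
          using path list_edges_rev[of "x # P @ [y]"] by simp
        then have "is_cycle E (x # A' @ y # rev P)"
          using nA dist dP P split by (intro is_cycleI) auto
        then show False using max[of "x # A' @ y # rev P"] len \<open>B' = []\<close> P(2) by (cases P) auto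
      qed
    qed
  qed
  then show ?thesis using cs by blast
qed

text \<open>With \<open>f\<close> the position on the cycle, two crossing edges are chords with
  alternating ends on it.\<close>

lemma cycle_noncrossing:
  assumes cs: "is_cycle E cs" "set cs = V"
  shows "\<exists>f :: 'a \<Rightarrow> nat. inj_on f V \<and> noncrossing f E"
proof -
  have dist: "distinct cs" using cs by (simp add: is_cycle_def)
  define f where "f = the_inv_into {..<length cs} ((!) cs)"
  have inj: "inj_on ((!) cs) {..<length cs}" using dist by (simp add: inj_on_nth)
  have f: "f v < length cs \<and> cs ! f v = v" if "v \<in> V" for v
  proof -
    have "v \<in> (!) cs ` {..<length cs}" using that cs(2) by (auto simp: in_set_conv_nth)
    then show ?thesis
      using the_inv_into_into[OF inj, of v "{..<length cs}"] f_the_inv_into_f[OF inj, of v]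
      by (auto simp: f_def)
  qed
  have "inj_on f V" using f by (metis inj_onI)
  moreover have "noncrossing f E"
    unfolding noncrossing_def
  proof (intro allI impI)
    fix a b c d assume h: "{a, c} \<in> E" "{b, d} \<in> E" "f a < f b" "f b < f c" "f c < f d"
    have V: "a \<in> V" "b \<in> V" "c \<in> V" "d \<in> V" using edge_vertices h by auto
    \<comment> \<open>\<open>M\<close> is the stretch of the cycle from \<open>a\<close> to
      \<open>c\<close>, which contains \<open>b\<close>; \<open>N @ A\<close> is the way back from
      \<open>c\<close> to \<open>a\<close>, which contains \<open>d\<close>.\<close>
    define A where "A = take (f a) cs"
    define M where "M = take (f c - Suc (f a)) (drop (Suc (f a)) cs)"
    define N where "N = drop (Suc (f c)) cs"
    have "cs = A @ a # drop (Suc (f a)) cs"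
      using id_take_nth_drop[of "f a" cs] f[OF V(1)] by (simp add: A_def)
    moreover have "drop (Suc (f a)) cs = M @ c # N"
      using id_take_nth_drop[of "f c - Suc (f a)" "drop (Suc (f a)) cs"] f[OF V(3)] h
        diff_less_mono[of "f c" "length cs" "Suc (f a)"]
      by (simp add: M_def N_def)
    ultimately have split: "cs = A @ a # M @ c # N" by simp
    have "b \<in> set M"
    proof -
      have "M ! (f b - Suc (f a)) = b" "f b - Suc (f a) < length M"
        using f[OF V(2)] f[OF V(3)] h by (auto simp: M_def)
      then show ?thesis by (metis nth_mem)
    qed
    moreover have "d \<in> set N"
    proof -
      have "N ! (f d - Suc (f c)) = d" "f d - Suc (f c) < length N"
        using f[OF V(4)] h by (auto simp: N_def)
      then show ?thesis by (metis nth_mem)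
    qed
    ultimately obtain A1 A2 B1 B2 where AB: "M = A1 @ b # A2" "rev (N @ A) = B1 @ d # B2"
      by (metis UnCI set_append set_rev split_list)
    have cyc: "is_cycle E (a # M @ c # N @ A)" using is_cycle_rotate[of E A a "M @ c # N"] cs(1) split by simp
    then have "distinct (a # c # M @ rev (N @ A))" by (auto simp: is_cycle_def)
    then show False
      using no_crossing_chords[of a c A1 b A2 B1 d B2] is_cycle_split[OF cyc] h(1,2) unfolding AB by simp
  qed
  ultimately show ?thesis by blast
qed

end

text \<open>Induction on the number of vertices: orders of the two sides of a separation are glued,
  and without a separation there is a Hamiltonian cycle to follow. With fewer than three vertices
  nothing can cross.\<close>

theorem outerplanar_noncrossing:
  assumes "outerplanar (V, E)"
  shows "\<exists>f :: 'a \<Rightarrow> nat. inj_on f V \<and> noncrossing f E"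
  using assms
proof (induction "card V" arbitrary: V E rule: less_induct)
  case less
  obtain p \<gamma> where s: "simple_graph (V, E)" and d: "outerplanar_drawing (V, E) p \<gamma>"
    using less.prems by (auto simp: outerplanar_def)
  interpret outer_drawing V E p \<gamma> by (rule outer_drawing.intro[OF s d])
  have fin: "finite V" using s by (simp add: simple_graph_def)
  show ?case
  proof (cases "\<exists>A B. separation V E A B")
    case True
    then obtain A B x where sep: "A \<union> B = V" "A \<noteq> V" "B \<noteq> V" "A \<inter> B \<subseteq> {x}"
        "\<And>a b. {a, b} \<in> E \<Longrightarrow> {a, b} \<subseteq> A \<or> {a, b} \<subseteq> B"
      unfolding separation_def by blast
    have card: "card A < card V" "card B < card V" using sep fin by (auto intro!: psubset_card_mono)
    have sub: "A \<subseteq> V" "B \<subseteq> V" using sep(1) by auto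
    obtain f1 :: "'a \<Rightarrow> nat" where f1: "inj_on f1 A" "noncrossing f1 {e \<in> E. e \<subseteq> A}"
      using less.hyps[OF card(1) outerplanar_induced[OF less.prems sub(1)]] by blast
    obtain f2 :: "'a \<Rightarrow> nat" where f2: "inj_on f2 B" "noncrossing f2 {e \<in> E. e \<subseteq> B}"
      using less.hyps[OF card(2) outerplanar_induced[OF less.prems sub(2)]] by blast
    have "finite A" "finite B" using sub fin finite_subset by blast+
    then show ?thesis
      using noncrossing_glue[OF _ _ sep(4,5) f1 f2] sep(1) by simp
  next
    case nosep: False
    show ?thesis
    proof (cases "3 \<le> card V")
      case True
      then obtain cs where "is_cycle E cs" "set cs = V" using hamiltonian_cycle nosep by metis
      then show ?thesis by (rule cycle_noncrossing)
    next
      case False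
      obtain f :: "'a \<Rightarrow> nat" where f: "inj_on f V"
        using finite_imp_inj_to_nat_seg[OF fin] by auto
      have "noncrossing f E"
        unfolding noncrossing_def
      proof (intro allI impI)
        fix a b c d assume h: "{a, c} \<in> E" "{b, d} \<in> E" "f a < f b" "f b < f c" "f c < f d"
        have "{a, b, c} \<subseteq> V" using edge_vertices[OF h(1)] edge_vertices[OF h(2)] by auto
        then have "card {a, b, c} \<le> card V" using fin by (rule card_mono[rotated])
        moreover have "a \<noteq> b" "b \<noteq> c" "a \<noteq> c" using h by auto
        ultimately show False using False by simp
      qed
      then show ?thesis using f by blast
    qed
  qed
qed

section \<open>Maximal outerpaths are strips\<close>

text \<open>The next triangle of the strip is glued to the side \<open>{h, z}\<close>, where \<open>z\<close> is the newest
  vertex. The last two clauses ensure that the long edge from \<open>h\<close> to the new vertex respects the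
  order.\<close>

definition strip_state :: "'a set set \<Rightarrow> ('a \<Rightarrow> nat) \<Rightarrow> 'a set \<Rightarrow> 'a \<Rightarrow> 'a \<Rightarrow> bool" where
  "strip_state E q S h z \<longleftrightarrow> strip_order q S E \<and> h \<in> S \<and> z \<in> S \<and> q h < q z \<and> (\<forall>v\<in>S. q v \<le> q z) \<and>
     (\<forall>c\<in>S. \<forall>d\<in>S. \<forall>y\<in>S. {c, d} \<in> E \<longrightarrow> q h < q c \<longrightarrow> q c < q y \<longrightarrow> q y < q d \<longrightarrow> False) \<and>
     (\<forall>a\<in>S. \<forall>b\<in>S. \<forall>x\<in>S. {a, b} \<in> E \<longrightarrow> q a < q h \<longrightarrow> q h < q x \<longrightarrow> q x < q b \<longrightarrow> False)"

text \<open>The new vertex \<open>w\<close> becomes the last one. Since \<open>z\<close> is its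
  predecessor, \<open>{z, w}\<close> jumps over nothing and only \<open>{h, w}\<close> is a new long
  edge. Either of these sides may carry the next triangle, which gives the two states.\<close>

lemma strip_state_extend:
  assumes st: "strip_state E q S h z" and w: "w \<notin> S" "{w} \<notin> E"
    and nb: "\<And>v. v \<in> S \<Longrightarrow> {v, w} \<in> E \<Longrightarrow> v = h \<or> v = z"
  shows "\<exists>q. strip_state E q (insert w S) h w \<and> strip_state E q (insert w S) z w"
proof -
  define r where "r = q(w := Suc (q z))"
  have inj: "inj_on q S" and hz: "h \<in> S" "z \<in> S" "q h < q z" and le: "\<And>v. v \<in> S \<Longrightarrow> q v \<le> q z"
    using st by (auto simp: strip_state_def strip_order_def)
  have r_old: "r v = q v" if "v \<in> S" for v using that w by (auto simp: r_def)
  have r_w: "r w = Suc (q z)" by (simp add: r_def)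
  have lt_w: "r v < r w" if "v \<in> S" for v using le[OF that] r_old[OF that] r_w by simp
  have inj_r: "inj_on r (insert w S)"
  proof (rule inj_onI)
    fix a b assume ab: "a \<in> insert w S" "b \<in> insert w S" "r a = r b"
    then consider "a = w" "b = w" | "a = w" "b \<in> S" | "a \<in> S" "b = w" | "a \<in> S" "b \<in> S" by blast
    then show "a = b"
    proof cases
      case 4
      then show ?thesis using ab(3) r_old inj by (simp add: inj_on_def)
    qed (use ab(3) lt_w[of a] lt_w[of b] in auto)
  qed
  have below: "v \<in> S" if "v \<in> insert w S" "r v < r u" "u \<in> insert w S" for u v
    using that lt_w[of u] by auto
  \<comment> \<open>An edge that jumps over a vertex is old or joins \<open>h\<close> to the new vertex.\<close>
  have long: "b \<in> S \<or> b = w \<and> a = h" if "{a, b} \<in> E" "a \<in> S" "b \<in> insert w S" "x \<in> S" "r a < r x" for a b x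
  proof (cases "b = w")
    case True
    then have "a = h \<or> a = z" using nb that by simp
    moreover have "a \<noteq> z" using that le[of x] r_old hz by auto
    ultimately show ?thesis using True by simp
  qed (use that in auto)
  have so: "strip_order r (insert w S) E"
    unfolding strip_order_def
  proof (intro conjI ballI impI inj_r)
    fix a b c d x y
    assume h: "a \<in> insert w S" "b \<in> insert w S" "c \<in> insert w S" "d \<in> insert w S" "x \<in> insert w S"
      "y \<in> insert w S" "{a, b} \<in> E" "{c, d} \<in> E"
      "r a < r c" "r c < r x" "r x < r b" "r c < r y" "r y < r d"
    have S: "a \<in> S" "c \<in> S" "x \<in> S" "y \<in> S" using below h by blast+
    have "b \<in> S \<or> b = w \<and> a = h" using long[of a b x] h S by auto
    moreover have "d \<in> S \<or> d = w \<and> c = h" using long[of c d y] h S by auto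
    moreover have "\<not> (a = h \<and> c = h)" using h by auto
    moreover have False if "b \<in> S" "d \<in> S"
      using strip_orderD[of q S E a b c d x y] st S that h r_old by (auto simp: strip_state_def)
    moreover have False if "b \<in> S" "c = h"
      using st S that h r_old unfolding strip_state_def by metis
    moreover have False if "d \<in> S" "a = h"
      using st S that h r_old unfolding strip_state_def by metis
    ultimately show False by blast
  qed
  have le_r: "r v \<le> r w" if "v \<in> insert w S" for v using that lt_w[of v] by auto
  have "strip_state E r (insert w S) h w"
    unfolding strip_state_def
  proof (intro conjI ballI impI so)
    fix c d y assume h: "c \<in> insert w S" "d \<in> insert w S" "y \<in> insert w S" "{c, d} \<in> E"
      "r h < r c" "r c < r y" "r y < r d"
    have S: "c \<in> S" "y \<in> S" using below h by blast+
    have "d \<in> S" using long[of c d y] h S by auto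
    then show False using st S h r_old hz unfolding strip_state_def by metis
  next
    fix a b x assume h: "a \<in> insert w S" "b \<in> insert w S" "x \<in> insert w S" "{a, b} \<in> E"
      "r a < r h" "r h < r x" "r x < r b"
    have S: "a \<in> S" "x \<in> S" using below[of a h] below[of x b] h hz by blast+
    have "b \<in> S" using long[of a b x] h S by auto
    then show False using st S h r_old hz unfolding strip_state_def by metis
  qed (use hz lt_w le_r in auto)
  \<comment> \<open>Only \<open>w\<close> comes after \<open>z\<close>, so the last two clauses have
    no instance.\<close>
  moreover have "strip_state E r (insert w S) z w"
    unfolding strip_state_def
  proof (intro conjI ballI impI so)
    fix c d y assume h: "c \<in> insert w S" "d \<in> insert w S" "y \<in> insert w S" "{c, d} \<in> E"
      "r z < r c" "r c < r y" "r y < r d"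
    have "c \<in> S" using below h by blast
    then show False using h le r_old hz by (metis not_less)
  next
    fix a b x assume h: "a \<in> insert w S" "b \<in> insert w S" "x \<in> insert w S" "{a, b} \<in> E"
      "r a < r z" "r z < r x" "r x < r b"
    have "x \<in> S" using below h by blast
    then show False using h le r_old hz by (metis not_less)
  qed (use hz lt_w le_r in auto)
  ultimately show ?thesis by blast
qed

section \<open>Peeling a triangulated polygon without branching triangles\<close>

locale unbranched_triangulation =
  fixes V :: "'a set" and E :: "'a set set"
  assumes max: "maximal_outerplanar (V, E)"
    and unbranched: "\<And>a b c x y z. {{a, b}, {b, c}, {a, c}, {a, x}, {b, x}, {b, y}, {c, y}, {a, z}, {c, z}} \<subseteq> E
      \<Longrightarrow> x \<noteq> c \<Longrightarrow> y \<noteq> a \<Longrightarrow> z \<noteq> b \<Longrightarrow> False"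
begin

lemma simple: "simple_graph (V, E)"
  using max by (simp add: maximal_outerplanar_def outerplanar_def)

lemma fin: "finite V" using simple by (simp add: simple_graph_def)

lemma EV: "{a, b} \<in> E \<Longrightarrow> a \<in> V \<and> b \<in> V \<and> a \<noteq> b"
  using simple by (force simp: simple_graph_def)

lemma crossing_edge:
  assumes "inj_on f V" "noncrossing f E" "u \<in> V" "v \<in> V" "f u < f v" "{u, v} \<notin> E"
  obtains b d where "b \<in> V" "d \<in> V" "{b, d} \<in> E" "f u < f b" "f b < f v" "f d < f u \<or> f v < f d"
  using maximal_outerplanar_nonedge_crossed[OF max assms] by blast

lemma noncrossingD:
  "noncrossing f E \<Longrightarrow> {a, c} \<in> E \<Longrightarrow> {b, d} \<in> E \<Longrightarrow> f a < f b \<Longrightarrow> f b < f c \<Longrightarrow> f c < f d \<Longrightarrow> False"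
  unfolding noncrossing_def by blast

text \<open>Take \<open>m\<close> as the last neighbour of \<open>u\<close> below the edge. If
  \<open>{m, w}\<close> were missing, an edge crossing it would also cross \<open>{u, w}\<close> or
  \<open>{u, m}\<close>, or give \<open>u\<close> a later neighbour.\<close>

lemma apex:
  assumes f: "inj_on f V" "noncrossing f E" and uw: "{u, w} \<in> E"
    and v: "v \<in> V" "f u < f v" "f v < f w"
  obtains m where "m \<in> V" "f u < f m" "f m < f w" "{u, m} \<in> E" "{m, w} \<in> E"
proof -
  have V: "u \<in> V" "w \<in> V" using EV[OF uw] by auto
  obtain m0 where m0: "m0 \<in> V" "f u < f m0" "f m0 < f w"
      and min: "\<And>v. v \<in> V \<Longrightarrow> f u < f v \<Longrightarrow> f v < f w \<Longrightarrow> f m0 \<le> f v"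
    using ex_has_least_nat[of "\<lambda>v. v \<in> V \<and> f u < f v \<and> f v < f w" v f] v by blast
  \<comment> \<open>Nothing lies between \<open>u\<close> and the nearest vertex \<open>m0\<close>,
    so no edge can cross this pair.\<close>
  have um0: "{u, m0} \<in> E"
  proof (rule ccontr)
    assume "{u, m0} \<notin> E"
    then obtain b where "b \<in> V" "f u < f b" "f b < f m0"
      using crossing_edge[OF f V(1) m0(1,2)] by metis
    then show False using min[of b] m0 by auto
  qed
  define B where "B = {m \<in> V. f u < f m \<and> f m < f w \<and> {u, m} \<in> E}"
  have "finite B" "B \<noteq> {}" using fin m0 um0 by (auto simp: B_def)
  then obtain m where mB: "m \<in> B" and maxm: "\<And>v. v \<in> B \<Longrightarrow> f v \<le> f m"
    using finite_has_greatest[of B f] by metis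
  then have m: "m \<in> V" "f u < f m" "f m < f w" "{u, m} \<in> E" by (auto simp: B_def)
  have "{m, w} \<in> E"
  proof (rule ccontr)
    assume "{m, w} \<notin> E"
    then obtain b d where bd: "b \<in> V" "d \<in> V" "{b, d} \<in> E" "f m < f b" "f b < f w" "f d < f m \<or> f w < f d"
      using crossing_edge[OF f m(1) V(2) m(3)] by metis
    have um: "{u, m} \<in> E" "f u < f m" and db: "{d, b} \<in> E" using m bd(3) by (auto simp: insert_commute)
    consider "f w < f d" | "f d < f u" | "d = u" | "f u < f d" "f d < f m"
      using bd(6) f(1) V bd(2) by (metis inj_onD linorder_neqE_nat)
    then show False
    proof cases
      case 1
      then show False using noncrossingD[OF f(2) uw bd(3)] um bd by auto
    next
      case 2
      then show False using noncrossingD[OF f(2) db uw] um bd by auto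
    next
      case 3
      then show False using maxm[of b] bd um db by (auto simp: B_def)
    next
      case 4
      then show False using noncrossingD[OF f(2) um(1) db] bd by auto
    qed
  qed
  then show ?thesis using that m by blast
qed

text \<open>The apex \<open>m\<close> below \<open>{u, w}\<close> splits the interval in two. As the
  triangle of \<open>u\<close>, \<open>m\<close>, \<open>w\<close> already has \<open>t\<close>
  behind one side, one of the halves contains no further vertex. The other half is a strip by
  induction, with the remaining corner now in the role of \<open>t\<close>, and this corner is then
  added as its newest vertex.\<close>

lemma strip_state_interval:
  assumes f: "inj_on f V" "noncrossing f E" and uw: "{u, w} \<in> E" "f u < f w"
    and t: "{t, u} \<in> E" "{t, w} \<in> E" "f t < f u \<or> f w < f t"
  shows "\<exists>q. strip_state E q {v \<in> V. f u \<le> f v \<and> f v \<le> f w} u w \<or>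
             strip_state E q {v \<in> V. f u \<le> f v \<and> f v \<le> f w} w u"
  using uw t
proof (induction "card {v \<in> V. f u \<le> f v \<and> f v \<le> f w}" arbitrary: u w t rule: less_induct)
  case less
  let ?I = "\<lambda>u w. {v \<in> V. f u \<le> f v \<and> f v \<le> f w}"
  note uw = less.prems(1,2) and t = less.prems(3-5)
  have V: "u \<in> V" "w \<in> V" using EV[OF uw(1)] by auto
  have f_eq: "f a = f b \<longleftrightarrow> a = b" if "a \<in> V" "b \<in> V" for a b using f(1) that by (auto simp: inj_on_def)
  show ?case
  proof (cases "\<exists>v\<in>V. f u < f v \<and> f v < f w")
    case False
    then have I: "?I u w = {u, w}" using V uw f_eq by (auto simp: le_less)
    have "u \<noteq> w" using uw by auto
    then have "strip_state E (\<lambda>v. if v = u then 0 else 1) {u, w} u w"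
      by (auto simp: strip_state_def strip_order_def inj_on_def)
    then show ?thesis unfolding I by blast
  next
    case True
    then obtain m where m: "m \<in> V" "f u < f m" "f m < f w" "{u, m} \<in> E" "{m, w} \<in> E"
      using apex[OF f uw(1)] by metis
    have "?I u m \<subseteq> ?I u w - {w}" "?I m w \<subseteq> ?I u w - {u}" "u \<in> ?I u w" "w \<in> ?I u w"
      using m V uw by auto
    then have "?I u m \<subset> ?I u w" "?I m w \<subset> ?I u w" by blast+
    then have sub: "card (?I u m) < card (?I u w)" "card (?I m w) < card (?I u w)"
      using fin by (simp_all add: psubset_card_mono)
    have "(\<forall>v\<in>V. \<not> (f u < f v \<and> f v < f m)) \<or> (\<forall>v\<in>V. \<not> (f m < f v \<and> f v < f w))"
    proof (rule ccontr)
      assume "\<not> ?thesis"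
      then obtain v v' where v: "v \<in> V" "f u < f v" "f v < f m" "v' \<in> V" "f m < f v'" "f v' < f w" by blast
      obtain x where x: "f x < f m" "{u, x} \<in> E" "{x, m} \<in> E" using apex[OF f m(4) v(1-3)] .
      obtain y where y: "f m < f y" "{m, y} \<in> E" "{y, w} \<in> E" using apex[OF f m(5) v(4-6)] .
      show False
        by (rule unbranched[of u m w x y t]) (use uw m x y t in \<open>auto simp: insert_commute\<close>)
    qed
    then show ?thesis
    proof
      assume empty: "\<forall>v\<in>V. \<not> (f m < f v \<and> f v < f w)"
      have "\<exists>q. strip_state E q (?I u m) u m \<or> strip_state E q (?I u m) m u"
        by (rule less.hyps[OF sub(1), of w]) (use m uw in \<open>auto simp: insert_commute\<close>)
      then obtain q where q: "strip_state E q (?I u m) u m \<or> strip_state E q (?I u m) m u" by blast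
      have I: "?I u w = insert w (?I u m)"
        using empty V m uw f_eq by (auto simp: le_less not_less)
      have nb: "v = u \<or> v = m" if "v \<in> ?I u m" "{v, w} \<in> E" for v
      proof (rule ccontr)
        assume "\<not> ?thesis"
        then have "f u < f v" "f v < f m" using that(1) f_eq V m by (auto simp: le_less)
        then show False using noncrossingD[OF f(2) m(4) that(2)] m by auto
      qed
      have "w \<notin> ?I u m" "{w} \<notin> E" using m EV[of w w] by auto
      then show ?thesis
        using q strip_state_extend[of E q "?I u m" u m w] strip_state_extend[of E q "?I u m" m u w] nb
        unfolding I by blast
    next
      assume empty: "\<forall>v\<in>V. \<not> (f u < f v \<and> f v < f m)"
      have "\<exists>q. strip_state E q (?I m w) m w \<or> strip_state E q (?I m w) w m"
        by (rule less.hyps[OF sub(2), of u]) (use m uw in \<open>auto simp: insert_commute\<close>)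
      then obtain q where q: "strip_state E q (?I m w) m w \<or> strip_state E q (?I m w) w m" by blast
      have I: "?I u w = insert u (?I m w)"
        using empty V m uw f_eq by (auto simp: le_less not_less)
      have nb: "v = m \<or> v = w" if "v \<in> ?I m w" "{v, u} \<in> E" for v
      proof (rule ccontr)
        assume "\<not> ?thesis"
        then have "f m < f v" "f v < f w" using that(1) f_eq V m by (auto simp: le_less)
        moreover have "{u, v} \<in> E" using that(2) by (simp add: insert_commute)
        ultimately show False using noncrossingD[OF f(2) _ m(5)] m by blast
      qed
      have "u \<notin> ?I m w" "{u} \<notin> E" using m EV[of u u] by auto
      then show ?thesis
        using q strip_state_extend[of E q "?I m w" m w u] strip_state_extend[of E q "?I m w" w m u] nb
        unfolding I by blast
    qed
  qed
qed

text \<open>Among the edges with a vertex below them, take one with the fewest: its apex triangle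
  leaves nothing below the other two sides.\<close>

lemma ear:
  assumes f: "inj_on f V" "noncrossing f E" and "3 \<le> card V"
  shows "\<exists>u m w. f u < f m \<and> f m < f w \<and> {u, m} \<in> E \<and> {m, w} \<in> E \<and> {u, w} \<in> E \<and>
    (\<forall>v\<in>V. f v \<le> f u \<or> v = m \<or> f w \<le> f v)"
proof -
  let ?I = "\<lambda>e. {v \<in> V. f (fst e) < f v \<and> f v < f (snd e)}"
  let ?P = "\<lambda>e. {fst e, snd e} \<in> E \<and> ?I e \<noteq> {}"
  have "V \<noteq> {}" using assms(3) by auto
  then obtain w0 where w0: "w0 \<in> V" "\<And>v. v \<in> V \<Longrightarrow> f v \<le> f w0" using finite_has_greatest[OF fin] by metis
  obtain u0 where u0: "u0 \<in> V" "\<And>v. v \<in> V \<Longrightarrow> f u0 \<le> f v"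
    using ex_has_least_nat[of "\<lambda>v. v \<in> V" w0 f] w0(1) by blast
  have "card {u0, w0} \<le> 2" by (simp add: card_insert_if)
  then have "\<not> V \<subseteq> {u0, w0}" using assms(3) card_mono[of "{u0, w0}" V] by auto
  then obtain v where v: "v \<in> V" "v \<noteq> u0" "v \<noteq> w0" by blast
  then have "f v \<noteq> f u0" "f v \<noteq> f w0" using f(1) u0 w0 by (auto simp: inj_on_def)
  then have between: "f u0 < f v" "f v < f w0" using u0(2)[of v] w0(2)[of v] v(1) by auto
  \<comment> \<open>The first and the last vertex are joined, because a crossing edge would have to
    end beyond them.\<close>
  have "{u0, w0} \<in> E"
  proof (rule ccontr)
    assume "{u0, w0} \<notin> E"
    then obtain d where "d \<in> V" "f d < f u0 \<or> f w0 < f d"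
      using crossing_edge[OF f u0(1) w0(1)] between by (metis less_trans)
    then show False using u0(2)[of d] w0(2)[of d] by auto
  qed
  then have "?P (u0, w0)" using v between by auto
  then obtain e where e: "?P e" and min: "\<And>e'. ?P e' \<Longrightarrow> card (?I e) \<le> card (?I e')"
    using ex_has_least_nat[of ?P "(u0, w0)" "\<lambda>e. card (?I e)"] by blast
  obtain u w where uw: "e = (u, w)" by (cases e)
  obtain m where m: "m \<in> V" "f u < f m" "f m < f w" "{u, m} \<in> E" "{m, w} \<in> E"
    using apex[OF f, of u w] e uw by auto
  have "?I (u, m) \<subseteq> ?I (u, w) - {m}" "?I (m, w) \<subseteq> ?I (u, w) - {m}" "m \<in> ?I (u, w)"
    using m by auto
  then have "?I (u, m) \<subset> ?I (u, w)" "?I (m, w) \<subset> ?I (u, w)" by blast+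
  then have "card (?I (u, m)) < card (?I (u, w))" "card (?I (m, w)) < card (?I (u, w))"
    using fin by (simp_all add: psubset_card_mono)
  then have "\<not> ?P (u, m)" "\<not> ?P (m, w)" using min[of "(u, m)"] min[of "(m, w)"] uw by auto
  then have empty: "?I (u, m) = {}" "?I (m, w) = {}" using m by auto
  have "f v \<le> f u \<or> v = m \<or> f w \<le> f v" if "v \<in> V" for v
  proof -
    have "f v = f m \<Longrightarrow> v = m" using f(1) that m(1) by (auto simp: inj_on_def)
    moreover have "\<not> (f u < f v \<and> f v < f m)" "\<not> (f m < f v \<and> f v < f w)" using empty that by auto
    ultimately show ?thesis by linarith
  qed
  then show ?thesis using m e uw by (intro exI[of _ u] exI[of _ m] exI[of _ w]) auto
qed

text \<open>Rotated to begin at the tip \<open>m\<close> of an ear, the order makes the other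
  vertices the interval from \<open>w\<close> to \<open>u\<close>, with \<open>m\<close> behind the
  edge \<open>{w, u}\<close>. Its strip is built first and \<open>m\<close> is appended
  last.\<close>

lemma strip_order_exists: "\<exists>q. strip_order q V E"
proof (cases "3 \<le> card V")
  case False
  obtain q :: "'a \<Rightarrow> nat" where q: "inj_on q V" using finite_imp_inj_to_nat_seg[OF fin] by auto
  have "strip_order q V E"
    unfolding strip_order_def
  proof (intro conjI ballI impI q)
    fix a b c d x y assume h: "a \<in> V" "b \<in> V" "c \<in> V" "x \<in> V" "q a < q c" "q c < q x" "q x < q b"
    have "card {a, c, x} \<le> card V" using h fin by (intro card_mono) auto
    moreover have "a \<noteq> c" "c \<noteq> x" "a \<noteq> x" using h by auto
    ultimately show False using False by simp
  qed
  then show ?thesis by blast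
next
  case True
  obtain f :: "'a \<Rightarrow> nat" where f: "inj_on f V" "noncrossing f E"
    using outerplanar_noncrossing[of V E] max by (auto simp: maximal_outerplanar_def)
  obtain u m w where umw: "f u < f m" "f m < f w" "{u, m} \<in> E" "{m, w} \<in> E" "{u, w} \<in> E"
      and between: "\<And>v. v \<in> V \<Longrightarrow> f v \<le> f u \<or> v = m \<or> f w \<le> f v"
    using ear[OF f True] by blast
  have V: "u \<in> V" "m \<in> V" "w \<in> V" using EV umw by blast+
  have ends: "\<forall>e\<in>E. e \<subseteq> V" using simple by (simp add: simple_graph_def)
  from noncrossing_rotate[OF fin ends f, of m]
  obtain g where g: "inj_on g V" "noncrossing g E"
    and *: "\<forall>u\<in>V. \<forall>v\<in>V. f u < f m \<longrightarrow> f m \<le> f v \<longrightarrow> g v < g u"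
      "\<forall>u\<in>V. \<forall>v\<in>V. (f u < f m \<longleftrightarrow> f v < f m) \<longrightarrow> (g u < g v \<longleftrightarrow> f u < f v)"
    by (elim exE conjE) simp
  note hi = *(1)[rule_format] and mono = *(2)[rule_format]
  have mw: "g m < g w" using mono[of m w] V umw by auto
  have wu: "g w < g u" using hi[of u w] V umw by auto
  have I: "{v \<in> V. g w \<le> g v \<and> g v \<le> g u} = V - {m}"
  proof -
    have "g w \<le> g v \<and> g v \<le> g u" if v: "v \<in> V" "v \<noteq> m" for v
    proof (cases "f v < f m")
      case True
      then have "f v \<le> f u" using between[OF v(1)] v(2) umw by auto
      then have "\<not> g u < g v" using mono[of u v] V v True umw by auto
      then show ?thesis using hi[of v w] V v True umw by auto
    next
      case False
      then have "f w \<le> f v" using between[OF v(1)] v(2) umw by auto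
      then have "\<not> g v < g w" using mono[of v w] V v False umw by auto
      then show ?thesis using hi[of u v] V v False umw by auto
    qed
    then show ?thesis using mw by auto
  qed
  have "\<exists>q. strip_state E q {v \<in> V. g w \<le> g v \<and> g v \<le> g u} w u \<or>
            strip_state E q {v \<in> V. g w \<le> g v \<and> g v \<le> g u} u w"
    by (rule strip_state_interval[OF g, where t = m]) (use umw mw wu in \<open>auto simp: insert_commute\<close>)
  then obtain q where q: "strip_state E q (V - {m}) w u \<or> strip_state E q (V - {m}) u w"
    unfolding I by blast
  have nb: "v = w \<or> v = u" if "v \<in> V - {m}" "{v, m} \<in> E" for v
  proof (rule ccontr)
    assume no: "\<not> ?thesis"
    have "v \<in> {v \<in> V. g w \<le> g v \<and> g v \<le> g u}" using that I by blast
    moreover have "g v \<noteq> g w" "g v \<noteq> g u" using no g(1) that V by (auto simp: inj_on_def)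
    ultimately have "g w < g v" "g v < g u" by auto
    moreover have "{m, v} \<in> E" "{w, u} \<in> E" using that umw by (simp_all add: insert_commute)
    ultimately show False using noncrossingD[OF g(2)] mw by blast
  qed
  have m: "m \<notin> V - {m}" "{m} \<notin> E" using EV[of m m] by auto
  have "\<exists>q h. strip_state E q (insert m (V - {m})) h m"
    using q strip_state_extend[of E q "V - {m}" w u m] strip_state_extend[of E q "V - {m}" u w m] nb m by blast
  then show ?thesis using V by (auto simp: strip_state_def insert_absorb)
qed

end

section \<open>From maximal outerpaths to outerpaths and the final count\<close>

lemma maximal_outerpath_strip_order:
  assumes "maximal_outerpath H"
  shows "\<exists>q. strip_order q (verts H) (edges H)"
proof -
  obtain V E where H: "H = (V, E)" by (cases H)
  obtain p \<gamma> where max: "maximal_outerplanar (V, E)" and d: "outerplanar_drawing (V, E) p \<gamma>"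
      and path: "path_graph (weak_dual (V, E) p \<gamma>)"
    using assms H by (auto simp: maximal_outerpath_def)
  have s: "simple_graph (V, E)" using max by (simp add: maximal_outerplanar_def outerplanar_def)
  interpret outer_drawing V E p \<gamma> by (rule outer_drawing.intro[OF s d])
  \<comment> \<open>All that is kept of the weak dual: triangles on all three sides of one triangle
    would give its face three neighbours.\<close>
  interpret unbranched_triangulation V E
  proof (rule unbranched_triangulation.intro[OF max])
    fix a b c x y z
    assume "{{a, b}, {b, c}, {a, c}, {a, x}, {b, x}, {b, y}, {c, y}, {a, z}, {c, z}} \<subseteq> E"
      and ne: "x \<noteq> c" "y \<noteq> a" "z \<noteq> b"
    then have "triangle a b c \<subseteq> E" "triangle a b x \<subseteq> E" "triangle b c y \<subseteq> E" "triangle a c z \<subseteq> E"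
      by (simp_all add: triangle_def)
    then show False using triangle_not_branching[OF path _ _ _ _ ne] by blast
  qed
  show ?thesis using strip_order_exists H by simp
qed

lemma outerpath_strip_order:
  assumes "outerpath G"
  shows "\<exists>q. strip_order q (verts G) (edges G)"
proof -
  obtain H :: "nat ugraph" and \<phi> where H: "maximal_outerpath H" and inj: "inj_on \<phi> (verts G)"
    and sub: "\<phi> ` verts G \<subseteq> verts H" and hom: "\<And>e. e \<in> edges G \<Longrightarrow> \<phi> ` e \<in> edges H"
    using assms by (auto simp: outerpath_def)
  obtain q where q: "strip_order q (verts H) (edges H)" using maximal_outerpath_strip_order[OF H] by blast
  \<comment> \<open>The order is pulled back along \<open>\<phi>\<close>. A strip order only forbids
    configurations of edges, and every edge of \<open>G\<close> becomes an edge of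
    \<open>H\<close>.\<close>
  have "inj_on (q \<circ> \<phi>) (verts G)"
    using inj q sub by (auto simp: strip_order_def intro: comp_inj_on inj_on_subset)
  moreover have False if "a \<in> verts G" "b \<in> verts G" "c \<in> verts G" "d \<in> verts G" "x \<in> verts G" "y \<in> verts G"
      "{a, b} \<in> edges G" "{c, d} \<in> edges G" "q (\<phi> a) < q (\<phi> c)" "q (\<phi> c) < q (\<phi> x)" "q (\<phi> x) < q (\<phi> b)"
      "q (\<phi> c) < q (\<phi> y)" "q (\<phi> y) < q (\<phi> d)" for a b c d x y
    using strip_orderD[OF q, of "\<phi> a" "\<phi> b" "\<phi> c" "\<phi> d" "\<phi> x" "\<phi> y"] hom[OF that(7)] hom[OF that(8)] sub that
    by auto
  ultimately have "strip_order (q \<circ> \<phi>) (verts G) (edges G)"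
    unfolding strip_order_def comp_def by blast
  then show ?thesis by blast
qed

lemma degree_induced_le:
  assumes "simple_graph G" "I \<subseteq> verts G" "v \<in> I"
  shows "degree (induced_subgraph G I) v \<le> card (nbrs (edges G) I v)"
proof -
  have "{e \<in> edges (induced_subgraph G I). v \<in> e} \<subseteq> (\<lambda>u. {u, v}) ` nbrs (edges G) I v"
  proof
    fix e assume "e \<in> {e \<in> edges (induced_subgraph G I). v \<in> e}"
    then have e: "e \<in> edges G" "e \<subseteq> I" "v \<in> e" by (auto simp: induced_subgraph_def)
    then have "card e = 2" using assms(1) by (auto simp: simple_graph_def)
    then obtain u where "e = {u, v}" using e(3) by (metis card_2_iff doubleton_eq_iff insertE singletonD)
    then show "e \<in> (\<lambda>u. {u, v}) ` nbrs (edges G) I v" using e by (auto simp: nbrs_def)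
  qed
  moreover have "finite (nbrs (edges G) I v)"
    using assms finite_subset[of I "verts G"] by (auto simp: nbrs_def simple_graph_def)
  ultimately show ?thesis unfolding degree_def by (meson surj_card_le)
qed

theorem theorem2:
  fixes G :: "'a ugraph" and n k :: nat
  assumes "n \<ge> 1" and "outerpath G" and "card (verts G) = n" and "k \<ge> 3"
  shows "\<exists>I. I \<subseteq> verts G \<and> max_degree (induced_subgraph G I) \<le> k \<and>
           real (card I) \<ge> (real k - 1) / real k * real n"
proof -
  have simple: "simple_graph G" using assms(2) by (simp add: outerpath_def)
  have fin: "finite (verts G)" using simple by (simp add: simple_graph_def)
  obtain q where q: "strip_order q (verts G) (edges G)" using outerpath_strip_order[OF assms(2)] by blast
  have "\<forall>v\<in>verts G. {v} \<notin> edges G" using simple by (force simp: simple_graph_def)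
  then obtain D where D: "D \<subseteq> verts G" "k * card D \<le> n"
      "\<forall>v\<in>verts G - D. card (nbrs (edges G) (verts G - D) v) \<le> k"
    using strip_deletion[OF fin q assms(4)] assms(3) by auto
  let ?I = "verts G - D"
  have cI: "real (card ?I) = real n - real (card D)"
    using card_Diff_subset[OF finite_subset[OF D(1) fin] D(1)] card_mono[OF fin D(1)] assms(3)
    by (simp add: of_nat_diff)
  have kD: "real k * real (card D) \<le> real n" using D(2) by (metis of_nat_le_iff of_nat_mult)
  have bound: "(real k - 1) / real k * real n \<le> real (card ?I)"
    unfolding cI using kD assms(4) by (simp add: field_simps)
  \<comment> \<open>This makes \<open>?I\<close> nonempty, so that \<open>max_degree\<close> is the
    maximum of a nonempty set.\<close>
  have "0 < (real k - 1) / real k * real n" using assms(1,4) by simp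
  then have "0 < real (card ?I)" using bound by linarith
  then have "?I \<noteq> {}" by (metis card.empty less_irrefl of_nat_0)
  moreover have "degree (induced_subgraph G ?I) v \<le> k" if "v \<in> ?I" for v
    using degree_induced_le[OF simple Diff_subset that] D(3) that by (meson le_trans)
  moreover have "verts (induced_subgraph G ?I) = ?I" by (auto simp: induced_subgraph_def)
  ultimately have "max_degree (induced_subgraph G ?I) \<le> k"
    using fin by (simp add: max_degree_def)
  then show ?thesis using bound by blast
qed

end
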